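(* Let $D$ be an integral domain. Then the space $\mathrm{Over_{qr}}(D)$ of quotient rings of $D$, endowed with the subspace topology induced by the Zariski topology of $\mathrm{Over}(D)$, is a spectral space.
   Context: Let $K$ be the quotient field of $D$. A spectral space is a topological space homeomorphic to the prime spectrum of a commutative unitary ring with the Zariski topology. An overring of $D$ is a ring $T$ with $D\subseteq T\subseteq K$; $\mathrm{Over}(D)$ is the set of all overrings of $D$, endowed with the Zariski topology, which has as a basis of open sets the sets $\mathcal{B}(x_1,\ldots,x_n):=\{T\in\mathrm{Over}(D)\mid x_1,\ldots,x_n\in T\}$, as $x_1,\ldots,x_n$ range in $K$. A quotient ring of $D$ is an overring of the form $S^{-1}D$ for some multiplicatively closed subset $S$ of $D$ (with $0\notin S$); $\mathrm{Over_{qr}}(D)$ is the set of all quotient rings of $D$. *)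

theory Defs
  imports "HOL-Algebra.Subrings" "HOL-Analysis.Abstract_Topology"
begin

section \<open>Spectral spaces\<close>

definition Spec :: "('r, 'm) ring_scheme \<Rightarrow> 'r set set" where
  "Spec R = {P. primeideal P R}"

definition spec_topology :: "('r, 'm) ring_scheme \<Rightarrow> 'r set topology" where
  "spec_topology R =
     topology (\<lambda>U. \<exists>A \<subseteq> carrier R. U = Spec R - {P \<in> Spec R. A \<subseteq> P})"

text \<open>
  HOL cannot quantify existentially over types, so the ring has to live on a subset of
  some fixed type.  The type \<open>('x + nat) set\<close> loses no generality: by Hochster's
  construction, a space that is homeomorphic to the spectrum of any commutative ring is
  already homeomorphic to the spectrum of one whose cardinality is at most the maximum of
  aleph-zero and the number of compact open sets of the space, and so injects into this type.
\<close>

definition spectral_space :: "'x topology \<Rightarrow> bool" where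
  "spectral_space X \<longleftrightarrow>
     (\<exists>R :: ('x + nat) set ring. cring R \<and> X homeomorphic_space spec_topology R)"


section \<open>Overrings and quotient rings of an integral domain\<close>

definition quotient_field_of :: "('a, 'm) ring_scheme \<Rightarrow> 'a set \<Rightarrow> bool" where
  "quotient_field_of K D \<longleftrightarrow> field K \<and> subdomain D K \<and>
     (\<forall>x \<in> carrier K. \<exists>a \<in> D. \<exists>b \<in> D - {\<zero>\<^bsub>K\<^esub>}. x = a \<otimes>\<^bsub>K\<^esub> inv\<^bsub>K\<^esub> b)"

definition Over :: "('a, 'm) ring_scheme \<Rightarrow> 'a set \<Rightarrow> 'a set set" where
  "Over K D = {T. subring T K \<and> D \<subseteq> T}"

definition over_basic :: "('a, 'm) ring_scheme \<Rightarrow> 'a set \<Rightarrow> 'a set \<Rightarrow> 'a set set" where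
  "over_basic K D F = {T \<in> Over K D. F \<subseteq> T}"

text \<open>Allowing the empty list of elements adds nothing to the basis, since every overring
  contains \<open>\<one>\<close>.\<close>

definition over_topology :: "('a, 'm) ring_scheme \<Rightarrow> 'a set \<Rightarrow> 'a set topology" where
  "over_topology K D =
     topology (arbitrary union_of
       (\<lambda>U. \<exists>F. finite F \<and> F \<subseteq> carrier K \<and> U = over_basic K D F))"

definition fractions :: "('a, 'm) ring_scheme \<Rightarrow> 'a set \<Rightarrow> 'a set \<Rightarrow> 'a set" where
  "fractions K S D = {a \<otimes>\<^bsub>K\<^esub> inv\<^bsub>K\<^esub> s | a s. a \<in> D \<and> s \<in> S}"

definition Over_qr :: "('a, 'm) ring_scheme \<Rightarrow> 'a set \<Rightarrow> 'a set set" where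
  "Over_qr K D = {T \<in> Over K D.
     \<exists>S. submonoid S K \<and> S \<subseteq> D \<and> \<zero>\<^bsub>K\<^esub> \<notin> S \<and> T = fractions K S D}"


section \<open>The two topologies are well defined\<close>

text \<open>The function \<open>topology\<close> is meaningful only on families satisfying \<open>istopology\<close>.\<close>

lemma openin_over_topology:
  "openin (over_topology K D) =
     arbitrary union_of (\<lambda>U. \<exists>F. finite F \<and> F \<subseteq> carrier K \<and> U = over_basic K D F)"
proof -
  have "over_basic K D F \<inter> over_basic K D G = over_basic K D (F \<union> G)" for F G
    by (auto simp: over_basic_def)
  then have "istopology (arbitrary union_of
      (\<lambda>U. \<exists>F. finite F \<and> F \<subseteq> carrier K \<and> U = over_basic K D F))"
    by (intro istopology_base) (metis finite_UnI Un_least)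
  then show ?thesis
    by (simp add: over_topology_def topology_inverse')
qed

lemma topspace_over_topology: "topspace (over_topology K D) = Over K D"
proof
  have "over_basic K D {} = Over K D"
    by (simp add: over_basic_def)
  then have "openin (over_topology K D) (Over K D)"
    unfolding openin_over_topology by (intro arbitrary_union_of_inc exI[of _ "{}"]) simp
  then show "Over K D \<subseteq> topspace (over_topology K D)"
    by (rule openin_subset)
  have "openin (over_topology K D) (topspace (over_topology K D))"
    by simp
  then show "topspace (over_topology K D) \<subseteq> Over K D"
    unfolding openin_over_topology union_of_def over_basic_def by blast
qed

lemma openin_spec_topology:
  assumes "cring R"
  shows "openin (spec_topology R) U \<longleftrightarrow>
    (\<exists>A \<subseteq> carrier R. U = Spec R - {P \<in> Spec R. A \<subseteq> P})"
proof -
  interpret cring R by fact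
  define D where "D = (\<lambda>A. Spec R - {P \<in> Spec R. A \<subseteq> P})"
  have int: "D A \<inter> D B = D {a \<otimes>\<^bsub>R\<^esub> b | a b. a \<in> A \<and> b \<in> B}" (is "_ = D ?C")
    if A: "A \<subseteq> carrier R" and B: "B \<subseteq> carrier R" for A B
  proof -
    have "(A \<subseteq> P \<or> B \<subseteq> P) \<longleftrightarrow> ?C \<subseteq> P" if P: "primeideal P R" for P
    proof -
      interpret P: primeideal P R by fact
      show ?thesis
      proof
        assume "A \<subseteq> P \<or> B \<subseteq> P"
        then show "?C \<subseteq> P"
          using A B P.I_l_closed P.I_r_closed by blast
      next
        assume C: "?C \<subseteq> P"
        show "A \<subseteq> P \<or> B \<subseteq> P"
        proof (rule ccontr)
          assume "\<not> ?thesis"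
          then obtain a b where "a \<in> A" "a \<notin> P" "b \<in> B" "b \<notin> P" by blast
          with A B C P.I_prime[of a b] show False by blast
        qed
      qed
    qed
    moreover have "D A \<inter> D B = {P \<in> Spec R. \<not> (A \<subseteq> P \<or> B \<subseteq> P)}" "D ?C = {P \<in> Spec R. \<not> ?C \<subseteq> P}"
      by (auto simp: D_def)
    ultimately show ?thesis by (simp add: Spec_def cong: conj_cong)
  qed
  have "istopology (\<lambda>U. \<exists>A \<subseteq> carrier R. U = D A)"
    unfolding istopology_def
  proof (intro conjI allI impI)
    fix U V assume "\<exists>A \<subseteq> carrier R. U = D A" "\<exists>A \<subseteq> carrier R. V = D A"
    then obtain A B where AB: "A \<subseteq> carrier R" "B \<subseteq> carrier R" "U = D A" "V = D B" by blast
    have "{a \<otimes>\<^bsub>R\<^esub> b | a b. a \<in> A \<and> b \<in> B} \<subseteq> carrier R"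
      using AB(1,2) by blast
    then show "\<exists>A \<subseteq> carrier R. U \<inter> V = D A"
      using int[OF AB(1,2)] AB(3,4) by blast
  next
    fix \<U> assume "\<forall>U \<in> \<U>. \<exists>A \<subseteq> carrier R. U = D A"
    then obtain f where f: "\<And>U. U \<in> \<U> \<Longrightarrow> f U \<subseteq> carrier R \<and> U = D (f U)" by metis
    have "\<Union>\<U> = (\<Union>U \<in> \<U>. D (f U))" using f by auto
    also have "\<dots> = D (\<Union>U \<in> \<U>. f U)" by (auto simp: D_def)
    finally show "\<exists>A \<subseteq> carrier R. \<Union>\<U> = D A"
      using f by (intro exI[of _ "\<Union>U \<in> \<U>. f U"]) blast
  qed
  then show ?thesis
    by (simp add: spec_topology_def D_def topology_inverse')
qed

lemma topspace_spec_topology: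
  assumes "cring R"
  shows "topspace (spec_topology R) = Spec R"
proof
  interpret cring R by fact
  have "\<not> carrier R \<subseteq> P" if "P \<in> Spec R" for P
  proof -
    interpret P: primeideal P R using that by (simp add: Spec_def)
    show ?thesis using P.I_notcarr P.a_subset by blast
  qed
  then have "Spec R = Spec R - {P \<in> Spec R. carrier R \<subseteq> P}" by blast
  then have "openin (spec_topology R) (Spec R)"
    using openin_spec_topology[OF assms] by blast
  then show "Spec R \<subseteq> topspace (spec_topology R)"
    by (rule openin_subset)
  show "topspace (spec_topology R) \<subseteq> Spec R"
    using openin_spec_topology[OF assms, of "topspace (spec_topology R)"] by auto
qed

end

theory Submission
  imports Defs "HOL-Computational_Algebra.Fraction_Field" "HOL-Algebra.Free_Abelian_Groups"
    "HOL-Algebra.Weak_Morphisms"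
begin

text \<open>
  A quotient ring \<open>T\<close> of \<open>D\<close> is determined by the set \<open>F\<close> of nonzero elements of \<open>D\<close> that are
  invertible in \<open>T\<close>, and the sets \<open>F\<close> that occur are exactly the saturated multiplicative ones:
  those that contain \<open>1\<close> but not \<open>0\<close>, and contain a product of elements of \<open>D\<close> iff they contain
  both factors.
  Every element of \<open>T\<close> has the form \<open>a / s\<close> with \<open>1 / s \<in> T\<close>, so in terms of \<open>F\<close> the Zariski topology
  has the sets \<open>{F. B \<subseteq> F}\<close> with \<open>B\<close> finite as a basis.  The family \<open>\<F>\<close> of
  saturated sets is closed under nonempty intersections, and membership in \<open>\<F>\<close> is a condition
  on finite subsets.  For any family \<open>\<F>\<close> of subsets of \<open>I\<close> with these two closure properties, a
  ring with spectrum \<open>\<F>\<close> is constructed here, by a variant of Hochster's method in which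
  a single explicit ring takes the place of his iterated extensions.

  Let \<open>L\<close> be the field of rational functions over \<open>\<int>\<close> in indeterminates \<open>X\<^sub>i\<close>, \<open>i \<in> I\<close>.
  Every \<open>G \<subseteq> I\<close> defines a non-archimedean Gauss norm on \<open>L\<close>, in which \<open>X\<^sub>i\<close> has norm \<open>1\<close> for
  \<open>i \<in> G\<close> and \<open>1/2\<close> otherwise.  The ring consists of the functions \<open>h\<close> from \<open>\<F>\<close> to \<open>L\<close> such that
  \<open>h F\<close> involves only the \<open>X\<^sub>i\<close> with \<open>i \<in> F\<close>, such that \<open>h F\<close> depends only on \<open>F \<inter> A\<close> for some
  finite \<open>A\<close>, and such that \<open>h F\<close> specializes to \<open>h G\<close> for \<open>G \<subseteq> F\<close>: the \<open>G\<close>-norm of \<open>h F - h G\<close> is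
  at most \<open>1/2\<close>.  Each \<open>F\<close> gives the prime ideal of all \<open>h\<close> with \<open>h F = 0\<close>.  That there are no
  other prime ideals rests on three facts.

  First, the support of \<open>h\<close> is a finite union of basic open sets (\<open>support_finitely_generated\<close>):
  it is closed under enlarging \<open>F\<close>, and it depends only on \<open>F \<inter> A\<close>.  Secondly, if \<open>h\<close> vanishes
  wherever \<open>g\<close> does, then \<open>g\<close> divides a power of \<open>h\<close> (\<open>sections_division\<close>): wherever \<open>g\<close>
  specializes to \<open>0\<close>, the norm of \<open>h\<close> is at most \<open>1/2\<close>, whereas the norms of the finitely many
  nonzero values of \<open>g\<close> are bounded away from \<open>0\<close>, so that the quotient of a high power of \<open>h\<close> by
  \<open>g\<close> specializes to \<open>0\<close>.  Hence whether a prime ideal contains \<open>h\<close> depends only on the support of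
  \<open>h\<close>.  Thirdly, every finite union of basic open sets is the support of a sum of monomials,
  because distinct monomials do not cancel.  A prime ideal is therefore determined by the set of
  those \<open>i\<close> whose indeterminate it omits, and this set belongs to \<open>\<F>\<close> (\<open>prime_is_vanishing\<close>).
\<close>

section \<open>Gauss norms of integer polynomials\<close>

lift_definition restrict_keys :: "('m \<Rightarrow>\<^sub>0 'b::zero) \<Rightarrow> 'm set \<Rightarrow> ('m \<Rightarrow>\<^sub>0 'b)"
  is "\<lambda>f S m. if m \<in> S then f m else 0"
  by (rule finite_subset) auto

lemma keys_restrict_keys: "Poly_Mapping.keys (restrict_keys f S) = Poly_Mapping.keys f \<inter> S"
  by transfer auto

lemma keys_diff_restrict_keys: "Poly_Mapping.keys (f - restrict_keys f S) = Poly_Mapping.keys (f :: 'm \<Rightarrow>\<^sub>0 int) - S"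
  by transfer auto

text \<open>
  The Gauss norm in which a monomial with exponent \<open>m\<close> has norm \<open>2\<^bsup>-w m\<^esup>\<close>.  Inserting \<open>0\<close> gives the
  zero polynomial the norm \<open>0\<close>.
\<close>
definition gauss_norm :: "('m \<Rightarrow> nat) \<Rightarrow> ('m \<Rightarrow>\<^sub>0 int) \<Rightarrow> real" where
  "gauss_norm w f = Max (insert 0 ((\<lambda>m. (1/2) ^ w m) ` Poly_Mapping.keys f))"

lemma gauss_norm_le_iff:
  "0 \<le> r \<Longrightarrow> gauss_norm w f \<le> r \<longleftrightarrow> (\<forall>m \<in> Poly_Mapping.keys f. (1/2) ^ w m \<le> r)"
  by (simp add: gauss_norm_def)

lemma gauss_norm_less_iff:
  "0 < r \<Longrightarrow> gauss_norm w f < r \<longleftrightarrow> (\<forall>m \<in> Poly_Mapping.keys f. (1/2) ^ w m < r)"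
  by (simp add: gauss_norm_def)

lemma gauss_norm_ge: "m \<in> Poly_Mapping.keys f \<Longrightarrow> (1/2) ^ w m \<le> gauss_norm w f"
  by (simp add: gauss_norm_def)

lemma gauss_norm_nonneg: "0 \<le> gauss_norm w f"
  by (simp add: gauss_norm_def)

lemma gauss_norm_zero [simp]: "gauss_norm w 0 = 0"
  by (simp add: gauss_norm_def)

lemma gauss_norm_pos:
  assumes "f \<noteq> 0"
  shows "0 < gauss_norm w f"
proof -
  obtain m where "m \<in> Poly_Mapping.keys f" using assms by fastforce
  then have "(1/2) ^ w m \<le> gauss_norm w f" by (rule gauss_norm_ge)
  moreover have "(0::real) < (1/2) ^ w m" by simp
  ultimately show ?thesis by linarith
qed

lemma gauss_norm_le_1: "gauss_norm w f \<le> 1"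
  by (simp add: gauss_norm_le_iff power_le_one)

lemma gauss_norm_attained:
  assumes "f \<noteq> 0"
  shows "\<exists>m \<in> Poly_Mapping.keys f. gauss_norm w f = (1/2) ^ w m"
proof -
  have "gauss_norm w f \<in> insert 0 ((\<lambda>m. (1/2) ^ w m) ` Poly_Mapping.keys f)"
    unfolding gauss_norm_def by (rule Max_in) auto
  then show ?thesis using gauss_norm_pos[OF assms, of w] by auto
qed

lemma gauss_norm_add: "gauss_norm w (f + g) \<le> max (gauss_norm w f) (gauss_norm w g)"
proof -
  have "(1/2) ^ w m \<le> max (gauss_norm w f) (gauss_norm w g)" if "m \<in> Poly_Mapping.keys (f + g)" for m
    using that keys_add[of f g] gauss_norm_ge[of m f w] gauss_norm_ge[of m g w] by (auto simp: le_max_iff_disj)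
  moreover have "0 \<le> max (gauss_norm w f) (gauss_norm w g)" by (simp add: gauss_norm_nonneg le_max_iff_disj)
  ultimately show ?thesis by (simp only: gauss_norm_le_iff) blast
qed

lemma keys_uminus_int [simp]: "Poly_Mapping.keys (- f) = Poly_Mapping.keys (f :: 'm \<Rightarrow>\<^sub>0 int)"
  by (auto simp: in_keys_iff)

lemma gauss_norm_uminus [simp]: "gauss_norm w (- f) = gauss_norm w f"
  by (simp add: gauss_norm_def)

locale weight =
  fixes w :: "'m::{ordered_cancel_comm_monoid_add, linorder} \<Rightarrow> nat"
  assumes weight_add: "w (m + n) = w m + w n"
begin

lemma weight_zero: "w 0 = 0"
  using weight_add[of 0 0] by simp

lemma gauss_norm_one [simp]: "gauss_norm w 1 = 1"
  by (simp add: gauss_norm_def weight_zero)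

lemma gauss_norm_mult_le: "gauss_norm w (f * g) \<le> gauss_norm w f * gauss_norm w g"
proof -
  have "(1/2) ^ w m \<le> gauss_norm w f * gauss_norm w g" if m: "m \<in> Poly_Mapping.keys (f * g)" for m
  proof -
    obtain a b where ab: "m = a + b" "a \<in> Poly_Mapping.keys f" "b \<in> Poly_Mapping.keys g"
      using keys_mult[of f g] m by blast
    then have "(1/2) ^ w m = (1/2) ^ w a * ((1/2) ^ w b :: real)"
      by (simp add: weight_add power_add)
    also have "\<dots> \<le> gauss_norm w f * gauss_norm w g"
      using ab gauss_norm_ge gauss_norm_nonneg by (intro mult_mono) auto
    finally show ?thesis .
  qed
  then show ?thesis by (simp add: gauss_norm_le_iff gauss_norm_nonneg)
qed

text \<open>
  Split off from either factor its leading part, the terms of maximal norm.  The product of the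
  leading parts is nonzero because polynomials form a domain, all its terms have the product of
  the two norms as their norm, and the remaining part of the product is too small to cancel any
  of them.
\<close>
lemma gauss_norm_mult: "gauss_norm w (f * g) = gauss_norm w f * gauss_norm w g"
proof (cases "f = 0 \<or> g = 0")
  case True
  then show ?thesis by auto
next
  case False
  define lead where "lead = (\<lambda>f. restrict_keys f {m. (1/2) ^ w m = gauss_norm w f})"
  have lead_nz: "lead p \<noteq> 0" if "p \<noteq> 0" for p
    using gauss_norm_attained[OF that, of w] keys_restrict_keys[of p "{m. (1/2) ^ w m = gauss_norm w p}"]
    by (auto simp: lead_def)
  have tail: "gauss_norm w (p - lead p) < gauss_norm w p" if "p \<noteq> 0" for p
  proof -
    have "(1/2) ^ w m < gauss_norm w p" if "m \<in> Poly_Mapping.keys (p - lead p)" for m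
      using that gauss_norm_ge[of m p w] unfolding lead_def keys_diff_restrict_keys by auto
    then show ?thesis using gauss_norm_pos[OF that, of w] by (simp add: gauss_norm_less_iff)
  qed
  have lead_le: "gauss_norm w (lead p) \<le> gauss_norm w p" for p
    by (auto simp: gauss_norm_le_iff gauss_norm_nonneg lead_def keys_restrict_keys)
  let ?r = "gauss_norm w f" and ?s = "gauss_norm w g"
  have rs: "0 < ?r" "0 < ?s" using False gauss_norm_pos by auto
  have "lead f * lead g \<noteq> 0" using lead_nz False by simp
  then obtain m where m: "m \<in> Poly_Mapping.keys (lead f * lead g)" by fastforce
  then obtain a b where ab: "m = a + b" "a \<in> Poly_Mapping.keys (lead f)" "b \<in> Poly_Mapping.keys (lead g)"
    using keys_mult[of "lead f" "lead g"] by blast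
  then have wm: "(1/2) ^ w m = ?r * ?s"
    by (simp add: weight_add power_add lead_def keys_restrict_keys)
  define rest where "rest = (f - lead f) * g + lead f * (g - lead g)"
  have "gauss_norm w ((f - lead f) * g) < ?r * ?s"
    using gauss_norm_mult_le[of "f - lead f" g] tail[of f] False rs
    by (smt (verit) mult_strict_right_mono)
  moreover have "gauss_norm w (lead f * (g - lead g)) < ?r * ?s"
    using gauss_norm_mult_le[of "lead f" "g - lead g"] tail[of g] lead_le[of f] False rs gauss_norm_nonneg[of w "g - lead g"]
    by (smt (verit) mult_strict_left_mono mult_right_mono)
  ultimately have "gauss_norm w rest < ?r * ?s"
    unfolding rest_def using gauss_norm_add[of w "(f - lead f) * g" "lead f * (g - lead g)"] by linarith
  then have "m \<notin> Poly_Mapping.keys rest"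
    using wm gauss_norm_ge[of m rest w] by linarith
  moreover have "f * g = lead f * lead g + rest"
    by (simp add: rest_def algebra_simps)
  ultimately have "m \<in> Poly_Mapping.keys (f * g)"
    using m by (simp add: in_keys_iff lookup_add)
  then have "?r * ?s \<le> gauss_norm w (f * g)" using gauss_norm_ge[of m "f * g" w] wm by simp
  then show ?thesis using gauss_norm_mult_le[of f g] by linarith
qed

end

section \<open>Gauss norms of rational functions\<close>

definition fract_norm :: "('m \<Rightarrow> nat) \<Rightarrow> ('m::{ordered_cancel_comm_monoid_add, linorder} \<Rightarrow>\<^sub>0 int) fract \<Rightarrow> real" where
  "fract_norm w x = (SOME r. \<exists>a b. b \<noteq> 0 \<and> x = Fract a b \<and> r = gauss_norm w a / gauss_norm w b)"

definition weight_zero_polys :: "('m \<Rightarrow> nat) \<Rightarrow> ('m \<Rightarrow>\<^sub>0 int) set" where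
  "weight_zero_polys w = {f. \<forall>m \<in> Poly_Mapping.keys f. w m = 0}"

text \<open>
  The norm is trivial on this subfield.  For the weight that counts the degree in the
  indeterminates outside \<open>G\<close>, it is the field of rational functions in the indeterminates from \<open>G\<close>.
\<close>
definition weight_zero_field :: "('m \<Rightarrow> nat) \<Rightarrow> ('m::{ordered_cancel_comm_monoid_add, linorder} \<Rightarrow>\<^sub>0 int) fract set" where
  "weight_zero_field w = {Fract a b |a b. b \<noteq> 0 \<and> a \<in> weight_zero_polys w \<and> b \<in> weight_zero_polys w}"

context weight
begin

text \<open>
  By multiplicativity of the Gauss norm, the quotient of the two norms is the same for all fractions
  that represent a given element.
\<close>
lemma fract_norm_Fract:
  assumes "b \<noteq> 0"
  shows "fract_norm w (Fract a b) = gauss_norm w a / gauss_norm w b"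
  unfolding fract_norm_def
proof (rule some_equality)
  show "\<exists>c d. d \<noteq> 0 \<and> Fract a b = Fract c d \<and> gauss_norm w a / gauss_norm w b = gauss_norm w c / gauss_norm w d"
    using assms by blast
next
  fix r assume "\<exists>c d. d \<noteq> 0 \<and> Fract a b = Fract c d \<and> r = gauss_norm w c / gauss_norm w d"
  then obtain c d where cd: "d \<noteq> 0" "Fract a b = Fract c d" "r = gauss_norm w c / gauss_norm w d" by blast
  then have "gauss_norm w (a * d) = gauss_norm w (c * b)" using assms by (simp add: eq_fract)
  then show "r = gauss_norm w a / gauss_norm w b"
    using cd assms gauss_norm_pos[of b w] gauss_norm_pos[of d w] by (simp add: gauss_norm_mult frac_eq_eq)
qed

lemma fract_norm_nonneg: "0 \<le> fract_norm w x"
  by (cases x) (simp add: fract_norm_Fract gauss_norm_nonneg)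

lemma fract_norm_zero [simp]: "fract_norm w 0 = 0"
  by (simp add: Zero_fract_def fract_norm_Fract)

lemma fract_norm_mult: "fract_norm w (x * y) = fract_norm w x * fract_norm w y"
  by (cases x, cases y) (simp add: fract_norm_Fract gauss_norm_mult)

lemma fract_norm_one [simp]: "fract_norm w 1 = 1"
  by (simp add: One_fract_def fract_norm_Fract)

lemma fract_norm_power: "fract_norm w (x ^ n) = fract_norm w x ^ n"
  by (induction n) (simp_all add: fract_norm_mult)

lemma fract_norm_eq_0_iff: "fract_norm w x = 0 \<longleftrightarrow> x = 0"
proof (cases x)
  case (Fract a b)
  then show ?thesis
    using gauss_norm_pos[of b w] gauss_norm_pos[of a w]
    by (cases "a = 0") (auto simp: fract_norm_Fract eq_fract Zero_fract_def)
qed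

lemma fract_norm_divide: "fract_norm w (x / y) = fract_norm w x / fract_norm w y"
proof (cases "y = 0")
  case False
  then have "fract_norm w (x / y) * fract_norm w y = fract_norm w x" by (simp flip: fract_norm_mult)
  then show ?thesis using False fract_norm_eq_0_iff[of y] by (simp add: field_simps)
qed simp

lemma fract_norm_uminus [simp]: "fract_norm w (- x) = fract_norm w x"
  by (cases x) (simp add: fract_norm_Fract)

lemma fract_norm_add: "fract_norm w (x + y) \<le> max (fract_norm w x) (fract_norm w y)"
proof (cases x, cases y)
  fix a b c d assume *: "x = Fract a b" "b \<noteq> 0" "y = Fract c d" "d \<noteq> 0"
  have "fract_norm w (x + y) = gauss_norm w (a * d + c * b) / (gauss_norm w b * gauss_norm w d)"
    using * by (simp add: fract_norm_Fract gauss_norm_mult)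
  also have "\<dots> \<le> max (gauss_norm w (a * d)) (gauss_norm w (c * b)) / (gauss_norm w b * gauss_norm w d)"
    by (intro divide_right_mono gauss_norm_add mult_nonneg_nonneg gauss_norm_nonneg)
  also have "\<dots> = max (fract_norm w x) (fract_norm w y)"
    using * gauss_norm_pos[of b w] gauss_norm_pos[of d w]
    by (auto simp: fract_norm_Fract gauss_norm_mult max_def field_simps)
  finally show ?thesis .
qed

lemma fract_norm_diff: "fract_norm w (x - y) \<le> max (fract_norm w x) (fract_norm w y)"
  using fract_norm_add[of x "- y"] by simp

lemma gauss_norm_weight_zero_polys:
  assumes "f \<in> weight_zero_polys w" "f \<noteq> 0"
  shows "gauss_norm w f = 1"
  using gauss_norm_attained[OF assms(2), of w] assms(1) by (auto simp: weight_zero_polys_def)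

lemma weight_zero_fieldI: "b \<noteq> 0 \<Longrightarrow> a \<in> weight_zero_polys w \<Longrightarrow> b \<in> weight_zero_polys w \<Longrightarrow> Fract a b \<in> weight_zero_field w"
  unfolding weight_zero_field_def by blast

lemma weight_zero_fieldE:
  assumes "x \<in> weight_zero_field w"
  obtains a b where "x = Fract a b" "b \<noteq> 0" "a \<in> weight_zero_polys w" "b \<in> weight_zero_polys w"
  using assms unfolding weight_zero_field_def by blast

lemma fract_norm_weight_zero_field:
  assumes "x \<in> weight_zero_field w" "x \<noteq> 0"
  shows "fract_norm w x = 1"
  using assms(1)
proof (rule weight_zero_fieldE)
  fix a b assume x: "x = Fract a b" "b \<noteq> 0" "a \<in> weight_zero_polys w" "b \<in> weight_zero_polys w"
  moreover from this assms(2) have "a \<noteq> 0" by (auto simp: fract_collapse)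
  ultimately show ?thesis by (simp add: fract_norm_Fract gauss_norm_weight_zero_polys)
qed

lemma fract_norm_weight_zero_field_le: "x \<in> weight_zero_field w \<Longrightarrow> fract_norm w x \<le> 1"
  using fract_norm_weight_zero_field[of x] by (cases "x = 0") auto

lemma weight_zero_polys_mult:
  assumes "f \<in> weight_zero_polys w" "g \<in> weight_zero_polys w"
  shows "f * g \<in> weight_zero_polys w"
  using keys_mult[of f g] assms by (fastforce simp: weight_add weight_zero_polys_def)

lemma weight_zero_polys_add: "f \<in> weight_zero_polys w \<Longrightarrow> g \<in> weight_zero_polys w \<Longrightarrow> f + g \<in> weight_zero_polys w"
  using keys_add[of f g] unfolding weight_zero_polys_def by blast

lemma weight_zero_field_mult:
  assumes "x \<in> weight_zero_field w" "y \<in> weight_zero_field w"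
  shows "x * y \<in> weight_zero_field w"
  by (rule weight_zero_fieldE[OF assms(1)], rule weight_zero_fieldE[OF assms(2)]) (simp add: weight_zero_fieldI weight_zero_polys_mult)

lemma weight_zero_field_add:
  assumes "x \<in> weight_zero_field w" "y \<in> weight_zero_field w"
  shows "x + y \<in> weight_zero_field w"
  by (rule weight_zero_fieldE[OF assms(1)], rule weight_zero_fieldE[OF assms(2)])
    (simp add: weight_zero_fieldI weight_zero_polys_mult weight_zero_polys_add)

lemma weight_zero_field_Fract: "a \<in> weight_zero_polys w \<Longrightarrow> Fract a 1 \<in> weight_zero_field w"
  by (intro weight_zero_fieldI) (auto simp: weight_zero weight_zero_polys_def)

lemma weight_zero_field_0: "0 \<in> weight_zero_field w" and weight_zero_field_1: "1 \<in> weight_zero_field w"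
  using weight_zero_field_Fract[of 0] weight_zero_field_Fract[of 1] by (simp_all add: fract_expand weight_zero weight_zero_polys_def)

lemma weight_zero_field_uminus: "x \<in> weight_zero_field w \<Longrightarrow> - x \<in> weight_zero_field w"
  by (elim weight_zero_fieldE) (simp add: weight_zero_fieldI weight_zero_polys_def)

lemma weight_zero_field_divide:
  assumes "x \<in> weight_zero_field w" "y \<in> weight_zero_field w"
  shows "x / y \<in> weight_zero_field w"
proof -
  have "inverse y \<in> weight_zero_field w"
  proof (cases "y = 0")
    case False
    with assms(2) show ?thesis
      by (elim weight_zero_fieldE) (auto simp: fract_collapse intro: weight_zero_fieldI)
  qed (simp add: weight_zero_field_0)
  then show ?thesis using assms(1) by (simp add: divide_inverse weight_zero_field_mult)
qed

end

section \<open>The degree outside a set of indeterminates\<close>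

definition outer_weight :: "'i set \<Rightarrow> ('i \<Rightarrow>\<^sub>0 nat) \<Rightarrow> nat" where
  "outer_weight G m = (\<Sum>i \<in> Poly_Mapping.keys m - G. Poly_Mapping.lookup m i)"

lemma outer_weight_superset:
  assumes "finite A" "Poly_Mapping.keys m \<subseteq> A"
  shows "outer_weight G m = (\<Sum>i \<in> A - G. Poly_Mapping.lookup m i)"
  unfolding outer_weight_def using assms by (intro sum.mono_neutral_left) (auto simp: in_keys_iff)

interpretation outer_weight: weight "outer_weight (G :: 'i::linorder set)" for G
proof
  fix m n :: "'i \<Rightarrow>\<^sub>0 nat"
  let ?A = "Poly_Mapping.keys m \<union> Poly_Mapping.keys n"
  have "outer_weight G (m + n) = (\<Sum>i \<in> ?A - G. Poly_Mapping.lookup (m + n) i)"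
    by (intro outer_weight_superset keys_add) auto
  also have "\<dots> = (\<Sum>i \<in> ?A - G. Poly_Mapping.lookup m i) + (\<Sum>i \<in> ?A - G. Poly_Mapping.lookup n i)"
    by (simp add: lookup_add sum.distrib)
  also have "\<dots> = outer_weight G m + outer_weight G n"
    by (simp add: outer_weight_superset[where A = ?A])
  finally show "outer_weight G (m + n) = outer_weight G m + outer_weight G n" .
qed

lemma outer_weight_le: "outer_weight G m \<le> outer_weight {} m"
  unfolding outer_weight_def by (intro sum_mono2) auto

text \<open>
  The degree outside \<open>G\<close> of a monomial never exceeds its total degree, and a denominator has norm at
  most \<open>1\<close>; so the total degree of any monomial of the numerator gives a bound that holds for all
  \<open>G\<close> at once.
\<close>
lemma fract_norm_lower_bound:
  fixes x :: "(('i::linorder \<Rightarrow>\<^sub>0 nat) \<Rightarrow>\<^sub>0 int) fract"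
  assumes "x \<noteq> 0"
  shows "\<exists>c>0. \<forall>G. c \<le> fract_norm (outer_weight G) x"
proof -
  obtain a b where x: "x = Fract a b" "b \<noteq> 0" "a \<noteq> 0"
    using assms by (cases x rule: Fract_cases_nonzero) auto
  then obtain m where m: "m \<in> Poly_Mapping.keys a" by fastforce
  have "(1/2) ^ outer_weight {} m \<le> fract_norm (outer_weight G) x" for G
  proof -
    have "(1/2 :: real) ^ outer_weight {} m \<le> (1/2) ^ outer_weight G m"
      by (intro power_decreasing outer_weight_le) auto
    also have "\<dots> \<le> gauss_norm (outer_weight G) a" by (rule gauss_norm_ge[OF m])
    also have "\<dots> \<le> gauss_norm (outer_weight G) a / gauss_norm (outer_weight G) b"
      using gauss_norm_pos[OF x(2), of "outer_weight G"] gauss_norm_le_1[of "outer_weight G" b] gauss_norm_nonneg[of "outer_weight G" a]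
      by (simp add: field_simps mult_left_le)
    finally show ?thesis using x by (simp add: outer_weight.fract_norm_Fract)
  qed
  then show ?thesis by (intro exI[of _ "(1/2) ^ outer_weight {} m"]) auto
qed

definition sqfree_exponent :: "'i set \<Rightarrow> ('i \<Rightarrow>\<^sub>0 nat)" where
  "sqfree_exponent B = (\<Sum>i\<in>B. Poly_Mapping.single i 1)"

definition sqfree_monomial :: "'i::linorder set \<Rightarrow> (('i \<Rightarrow>\<^sub>0 nat) \<Rightarrow>\<^sub>0 int) fract" where
  "sqfree_monomial B = Fract (Poly_Mapping.single (sqfree_exponent B) 1) 1"

lemma lookup_sqfree_exponent: "finite B \<Longrightarrow> Poly_Mapping.lookup (sqfree_exponent B) i = (if i \<in> B then 1 else 0)"
  by (simp add: sqfree_exponent_def lookup_sum lookup_single when_def)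

lemma keys_sqfree_exponent: "finite B \<Longrightarrow> Poly_Mapping.keys (sqfree_exponent B) = B"
  by (simp add: set_eq_iff in_keys_iff lookup_sqfree_exponent)

lemma outer_weight_sqfree_exponent: "finite B \<Longrightarrow> outer_weight G (sqfree_exponent B) = card (B - G)"
  by (simp add: outer_weight_def keys_sqfree_exponent lookup_sqfree_exponent)

lemma sqfree_monomial_empty: "sqfree_monomial {} = 1"
  by (simp add: sqfree_monomial_def sqfree_exponent_def One_fract_def)

lemma sqfree_monomial_insert: "finite B \<Longrightarrow> i \<notin> B \<Longrightarrow> sqfree_monomial (insert i B) = sqfree_monomial {i} * sqfree_monomial B"
  by (simp add: sqfree_monomial_def sqfree_exponent_def mult_single)

lemma sqfree_monomial_weight_zero_field: "finite B \<Longrightarrow> B \<subseteq> F \<Longrightarrow> sqfree_monomial B \<in> weight_zero_field (outer_weight F)"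
  unfolding sqfree_monomial_def by (intro outer_weight.weight_zero_field_Fract) (auto simp: outer_weight_sqfree_exponent weight_zero_polys_def)

lemma fract_norm_sqfree_monomial: "finite B \<Longrightarrow> fract_norm (outer_weight G) (sqfree_monomial B) = (1/2) ^ card (B - G)"
  by (simp add: sqfree_monomial_def outer_weight.fract_norm_Fract gauss_norm_def outer_weight_sqfree_exponent outer_weight.weight_zero)

lemma sum_sqfree_monomial_nonzero:
  assumes "finite \<B>" "\<And>B. B \<in> \<B> \<Longrightarrow> finite B" "\<B> \<noteq> {}"
  shows "(\<Sum>B\<in>\<B>. sqfree_monomial B) \<noteq> 0"
proof -
  have sum: "(\<Sum>B\<in>\<C>. sqfree_monomial B) = Fract (\<Sum>B\<in>\<C>. Poly_Mapping.single (sqfree_exponent B) 1) 1" if "finite \<C>" for \<C> :: "'a set set"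
    using that by (induction) (auto simp: sqfree_monomial_def Zero_fract_def)
  obtain C where C: "C \<in> \<B>" using assms by blast
  have inj: "sqfree_exponent B = sqfree_exponent C \<longleftrightarrow> B = C" if "B \<in> \<B>" for B
    using keys_sqfree_exponent[OF assms(2)[OF that]] keys_sqfree_exponent[OF assms(2)[OF C]] by metis
  have "Poly_Mapping.lookup (Poly_Mapping.single (sqfree_exponent B) (1::int)) (sqfree_exponent C) = (if B = C then 1 else 0)"
    if "B \<in> \<B>" for B
    using inj[OF that] by (cases "B = C") (simp_all add: lookup_single_not_eq)
  then have "Poly_Mapping.lookup (\<Sum>B\<in>\<B>. Poly_Mapping.single (sqfree_exponent B) (1::int)) (sqfree_exponent C) = 1"
    using assms(1) C by (simp add: lookup_sum)
  then have "(\<Sum>B\<in>\<B>. Poly_Mapping.single (sqfree_exponent B) (1::int)) \<noteq> 0" by force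
  then show ?thesis by (simp add: sum[OF assms(1)] Zero_fract_def eq_fract)
qed

section \<open>The ring of sections over a family of sets\<close>

type_synonym 'i ratfun = "(('i \<Rightarrow>\<^sub>0 nat) \<Rightarrow>\<^sub>0 int) fract"

text \<open>
  The four conditions: extension by \<open>0\<close>, so that sections are equal iff they agree on \<open>\<F>\<close>; finite
  dependence; values in the field of rational functions in the indeterminates from \<open>F\<close>; and
  compatibility with the place that sends the remaining indeterminates of \<open>F\<close> to \<open>0\<close> whenever
  \<open>G \<subseteq> F\<close>.  Asking for \<open>1/2\<close> instead of a norm below \<open>1\<close> gives powers of a section that
  specializes to \<open>0\<close> a rate of decay that is uniform in \<open>F\<close> and \<open>G\<close>.
\<close>
definition sections :: "'i::linorder set set \<Rightarrow> ('i set \<Rightarrow> 'i ratfun) set" where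
  "sections \<F> = {h. (\<forall>F. F \<notin> \<F> \<longrightarrow> h F = 0) \<and>
     (\<exists>A. finite A \<and> (\<forall>F\<in>\<F>. \<forall>G\<in>\<F>. F \<inter> A = G \<inter> A \<longrightarrow> h F = h G)) \<and>
     (\<forall>F\<in>\<F>. h F \<in> weight_zero_field (outer_weight F)) \<and>
     (\<forall>F\<in>\<F>. \<forall>G\<in>\<F>. G \<subseteq> F \<longrightarrow> fract_norm (outer_weight G) (h F - h G) \<le> 1/2)}"

definition section_ring :: "'i::linorder set set \<Rightarrow> ('i set \<Rightarrow> 'i ratfun) ring" where
  "section_ring \<F> = \<lparr>carrier = sections \<F>, mult = (\<lambda>f g F. f F * g F),
     one = (\<lambda>F. if F \<in> \<F> then 1 else 0), ring.zero = (\<lambda>F. 0), add = (\<lambda>f g F. f F + g F)\<rparr>"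

lemma section_ring_simps [simp]:
  "carrier (section_ring \<F>) = sections \<F>"
  "f \<otimes>\<^bsub>section_ring \<F>\<^esub> g = (\<lambda>F. f F * g F)"
  "\<one>\<^bsub>section_ring \<F>\<^esub> = (\<lambda>F. if F \<in> \<F> then 1 else 0)"
  "\<zero>\<^bsub>section_ring \<F>\<^esub> = (\<lambda>F. 0)"
  "f \<oplus>\<^bsub>section_ring \<F>\<^esub> g = (\<lambda>F. f F + g F)"
  by (simp_all add: section_ring_def)

lemma sectionsI:
  assumes "\<And>F. F \<notin> \<F> \<Longrightarrow> h F = 0"
    and "finite A" "\<And>F G. F \<in> \<F> \<Longrightarrow> G \<in> \<F> \<Longrightarrow> F \<inter> A = G \<inter> A \<Longrightarrow> h F = h G"
    and "\<And>F. F \<in> \<F> \<Longrightarrow> h F \<in> weight_zero_field (outer_weight F)"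
    and "\<And>F G. F \<in> \<F> \<Longrightarrow> G \<in> \<F> \<Longrightarrow> G \<subseteq> F \<Longrightarrow> fract_norm (outer_weight G) (h F - h G) \<le> 1/2"
  shows "h \<in> sections \<F>"
proof -
  have "\<forall>F\<in>\<F>. \<forall>G\<in>\<F>. F \<inter> A = G \<inter> A \<longrightarrow> h F = h G"
    by (intro ballI impI) (rule assms(3))
  moreover have "\<forall>F. F \<notin> \<F> \<longrightarrow> h F = 0" by (simp add: assms(1))
  moreover have "\<forall>F\<in>\<F>. h F \<in> weight_zero_field (outer_weight F)" by (simp add: assms(4))
  moreover have "\<forall>F\<in>\<F>. \<forall>G\<in>\<F>. G \<subseteq> F \<longrightarrow> fract_norm (outer_weight G) (h F - h G) \<le> 1/2"
    by (intro ballI impI) (rule assms(5))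
  ultimately show ?thesis
    unfolding sections_def using assms(2) by (intro CollectI conjI exI[of _ A])
qed

lemma sections_outside: "h \<in> sections \<F> \<Longrightarrow> F \<notin> \<F> \<Longrightarrow> h F = 0"
  by (simp add: sections_def)

lemma sections_finite_support:
  assumes "h \<in> sections \<F>"
  obtains A where "finite A" "\<And>F G. F \<in> \<F> \<Longrightarrow> G \<in> \<F> \<Longrightarrow> F \<inter> A = G \<inter> A \<Longrightarrow> h F = h G"
proof -
  have "\<exists>A. finite A \<and> (\<forall>F\<in>\<F>. \<forall>G\<in>\<F>. F \<inter> A = G \<inter> A \<longrightarrow> h F = h G)"
    using assms by (simp only: sections_def mem_Collect_eq)
  then show ?thesis using that by (elim exE conjE) (metis (no_types, lifting))
qed

lemma sections_weight_zero_field: "h \<in> sections \<F> \<Longrightarrow> F \<in> \<F> \<Longrightarrow> h F \<in> weight_zero_field (outer_weight F)"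
  by (simp add: sections_def)

lemma sections_specialize:
  "h \<in> sections \<F> \<Longrightarrow> F \<in> \<F> \<Longrightarrow> G \<in> \<F> \<Longrightarrow> G \<subseteq> F \<Longrightarrow> fract_norm (outer_weight G) (h F - h G) \<le> 1/2"
  by (simp add: sections_def)

lemma sections_fract_norm_le_1:
  assumes "h \<in> sections \<F>" "F \<in> \<F>" "G \<in> \<F>" "G \<subseteq> F"
  shows "fract_norm (outer_weight G) (h F) \<le> 1"
proof -
  have "fract_norm (outer_weight G) ((h F - h G) + h G) \<le> max (fract_norm (outer_weight G) (h F - h G)) (fract_norm (outer_weight G) (h G))"
    by (rule outer_weight.fract_norm_add)
  also have "\<dots> \<le> 1"
    using sections_specialize[OF assms] outer_weight.fract_norm_weight_zero_field_le[OF sections_weight_zero_field[OF assms(1,3)]] by simp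
  finally show ?thesis by simp
qed

text \<open>
  Nonzero elements of the field at \<open>G\<close> have norm \<open>1\<close>, so \<open>0\<close> cannot specialize to one of them.
\<close>
lemma sections_generization:
  assumes "h \<in> sections \<F>" "F \<in> \<F>" "G \<in> \<F>" "G \<subseteq> F" "h G \<noteq> 0"
  shows "h F \<noteq> 0"
  using sections_specialize[OF assms(1-4)] outer_weight.fract_norm_weight_zero_field[OF sections_weight_zero_field[OF assms(1,3)] assms(5)]
  by auto

lemma sections_unit_at:
  assumes "h \<in> sections \<F>" "F \<in> \<F>" "G \<in> \<F>" "G \<subseteq> F" "h G \<noteq> 0"
  shows "fract_norm (outer_weight G) (h F) = 1"
proof -
  have "fract_norm (outer_weight G) (h F - (h F - h G)) \<le> max (fract_norm (outer_weight G) (h F)) (fract_norm (outer_weight G) (h F - h G))"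
    by (rule outer_weight.fract_norm_diff)
  then show ?thesis
    using sections_fract_norm_le_1[OF assms(1-4)] sections_specialize[OF assms(1-4)]
      outer_weight.fract_norm_weight_zero_field[OF sections_weight_zero_field[OF assms(1,3)] assms(5)] by simp
qed

lemma sections_add:
  assumes f: "f \<in> sections \<F>" and g: "g \<in> sections \<F>"
  shows "(\<lambda>F. f F + g F) \<in> sections \<F>"
proof -
  obtain A where A: "finite A" "\<And>F G. F \<in> \<F> \<Longrightarrow> G \<in> \<F> \<Longrightarrow> F \<inter> A = G \<inter> A \<Longrightarrow> f F = f G"
    using sections_finite_support[OF f] by blast
  obtain B where B: "finite B" "\<And>F G. F \<in> \<F> \<Longrightarrow> G \<in> \<F> \<Longrightarrow> F \<inter> B = G \<inter> B \<Longrightarrow> g F = g G"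
    using sections_finite_support[OF g] by blast
  show ?thesis
  proof (rule sectionsI[where A = "A \<union> B"])
    fix F G assume FG: "F \<in> \<F>" "G \<in> \<F>"
    show "f F + g F = f G + g G" if "F \<inter> (A \<union> B) = G \<inter> (A \<union> B)"
    proof -
      have "F \<inter> A = G \<inter> A" "F \<inter> B = G \<inter> B" using that by blast+
      then show ?thesis using A(2) B(2) FG by metis
    qed
    show "fract_norm (outer_weight G) (f F + g F - (f G + g G)) \<le> 1/2" if "G \<subseteq> F"
    proof -
      have "f F + g F - (f G + g G) = (f F - f G) + (g F - g G)" by simp
      then have "fract_norm (outer_weight G) (f F + g F - (f G + g G)) \<le>
          max (fract_norm (outer_weight G) (f F - f G)) (fract_norm (outer_weight G) (g F - g G))"
        using outer_weight.fract_norm_add by metis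
      also have "\<dots> \<le> 1/2"
        using sections_specialize[OF f FG that] sections_specialize[OF g FG that] by simp
      finally show ?thesis .
    qed
  qed (use f g A(1) B(1) in \<open>auto simp: sections_outside sections_weight_zero_field outer_weight.weight_zero_field_add\<close>)
qed

lemma sections_mult:
  assumes f: "f \<in> sections \<F>" and g: "g \<in> sections \<F>"
  shows "(\<lambda>F. f F * g F) \<in> sections \<F>"
proof -
  obtain A where A: "finite A" "\<And>F G. F \<in> \<F> \<Longrightarrow> G \<in> \<F> \<Longrightarrow> F \<inter> A = G \<inter> A \<Longrightarrow> f F = f G"
    using sections_finite_support[OF f] by blast
  obtain B where B: "finite B" "\<And>F G. F \<in> \<F> \<Longrightarrow> G \<in> \<F> \<Longrightarrow> F \<inter> B = G \<inter> B \<Longrightarrow> g F = g G"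
    using sections_finite_support[OF g] by blast
  show ?thesis
  proof (rule sectionsI[where A = "A \<union> B"])
    fix F G assume FG: "F \<in> \<F>" "G \<in> \<F>"
    show "f F * g F = f G * g G" if "F \<inter> (A \<union> B) = G \<inter> (A \<union> B)"
    proof -
      have "F \<inter> A = G \<inter> A" "F \<inter> B = G \<inter> B" using that by blast+
      then show ?thesis using A(2) B(2) FG by metis
    qed
    show "fract_norm (outer_weight G) (f F * g F - f G * g G) \<le> 1/2" if "G \<subseteq> F"
    proof -
      have 1: "fract_norm (outer_weight G) ((f F - f G) * g F) \<le> 1/2 * 1"
        unfolding outer_weight.fract_norm_mult
        using sections_specialize[OF f FG that] sections_fract_norm_le_1[OF g FG that]
        by (intro mult_mono outer_weight.fract_norm_nonneg) auto
      have 2: "fract_norm (outer_weight G) (f G * (g F - g G)) \<le> 1 * (1/2)"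
        unfolding outer_weight.fract_norm_mult
        using sections_specialize[OF g FG that] sections_fract_norm_le_1[OF f FG(2,2)]
        by (intro mult_mono outer_weight.fract_norm_nonneg) auto
      have "f F * g F - f G * g G = (f F - f G) * g F + f G * (g F - g G)"
        by (simp add: algebra_simps)
      then have "fract_norm (outer_weight G) (f F * g F - f G * g G) \<le>
          max (fract_norm (outer_weight G) ((f F - f G) * g F)) (fract_norm (outer_weight G) (f G * (g F - g G)))"
        using outer_weight.fract_norm_add by metis
      also have "\<dots> \<le> 1/2"
        using 1 2 by simp
      finally show ?thesis .
    qed
  qed (use f g A(1) B(1) in \<open>auto simp: sections_outside sections_weight_zero_field outer_weight.weight_zero_field_mult\<close>)
qed

lemma sections_zero: "(\<lambda>F. 0) \<in> sections \<F>"
  by (rule sectionsI[where A = "{}"]) (auto simp: outer_weight.weight_zero_field_0)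

lemma sections_one: "(\<lambda>F. if F \<in> \<F> then 1 else 0) \<in> sections \<F>"
  by (rule sectionsI[where A = "{}"]) (auto simp: outer_weight.weight_zero_field_1)

lemma sections_uminus:
  assumes "f \<in> sections \<F>"
  shows "(\<lambda>F. - f F) \<in> sections \<F>"
proof -
  obtain A where A: "finite A" "\<And>F G. F \<in> \<F> \<Longrightarrow> G \<in> \<F> \<Longrightarrow> F \<inter> A = G \<inter> A \<Longrightarrow> f F = f G"
    using sections_finite_support[OF assms] by blast
  show ?thesis
  proof (rule sectionsI[where A = A])
    fix F G assume "F \<in> \<F>" "G \<in> \<F>" "G \<subseteq> F"
    then have "fract_norm (outer_weight G) (- (f F - f G)) \<le> 1/2"
      using sections_specialize[OF assms] by (simp del: minus_diff_eq)
    then show "fract_norm (outer_weight G) (- f F - - f G) \<le> 1/2" by simp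
  qed (use assms A(1) in \<open>auto simp: sections_outside sections_weight_zero_field outer_weight.weight_zero_field_uminus dest: A(2)\<close>)
qed

lemma sections_power:
  assumes "f \<in> sections \<F>"
  shows "(\<lambda>F. f F ^ Suc n) \<in> sections \<F>"
  using assms by (induction n) (use sections_mult in \<open>fastforce+\<close>)

lemma cring_section_ring: "cring (section_ring \<F>)"
proof (rule cringI)
  show "abelian_group (section_ring \<F>)"
  proof (rule abelian_groupI)
    fix f assume "f \<in> carrier (section_ring \<F>)"
    then show "\<exists>g \<in> carrier (section_ring \<F>). g \<oplus>\<^bsub>section_ring \<F>\<^esub> f = \<zero>\<^bsub>section_ring \<F>\<^esub>"
      by (intro bexI[of _ "\<lambda>F. - f F"]) (auto intro: sections_uminus)
  qed (auto simp: sections_add sections_zero algebra_simps)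
  show "comm_monoid (section_ring \<F>)"
    by (rule comm_monoidI) (auto simp: sections_mult sections_one sections_outside algebra_simps)
qed (auto simp: algebra_simps)

text \<open>
  By finite dependence a value is determined by one of the finitely many subsets of \<open>A\<close>.
\<close>
lemma sections_finite_values:
  assumes "h \<in> sections \<F>"
  shows "finite (h ` \<F>)"
proof -
  obtain A where A: "finite A" "\<And>F G. F \<in> \<F> \<Longrightarrow> G \<in> \<F> \<Longrightarrow> F \<inter> A = G \<inter> A \<Longrightarrow> h F = h G"
    using sections_finite_support[OF assms] by blast
  define r where "r = (\<lambda>B. SOME F. F \<in> \<F> \<and> F \<inter> A = B)"
  have "h F = h (r (F \<inter> A))" if "F \<in> \<F>" for F
  proof -
    have "r (F \<inter> A) \<in> \<F> \<and> r (F \<inter> A) \<inter> A = F \<inter> A"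
      unfolding r_def by (rule someI[of _ F]) (use that in auto)
    then show ?thesis using A(2)[OF that] by metis
  qed
  then have "h ` \<F> \<subseteq> (\<lambda>B. h (r B)) ` Pow A" by blast
  then show ?thesis using A(1) by (meson finite_Pow_iff finite_imageI finite_subset)
qed

lemma sections_lower_bound:
  assumes "h \<in> sections \<F>"
  obtains c where "c > 0" "\<And>F G. F \<in> \<F> \<Longrightarrow> h F \<noteq> 0 \<Longrightarrow> c \<le> fract_norm (outer_weight G) (h F)"
proof -
  define V where "V = h ` \<F> - {0}"
  have "\<forall>x\<in>V. \<exists>c>0. \<forall>G. c \<le> fract_norm (outer_weight G) x"
    using fract_norm_lower_bound by (auto simp: V_def)
  then obtain b where b: "\<And>x. x \<in> V \<Longrightarrow> b x > 0 \<and> (\<forall>G. b x \<le> fract_norm (outer_weight G) x)" by metis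
  have fin: "finite V" using sections_finite_values[OF assms] by (simp add: V_def)
  define c where "c = Min (insert 1 (b ` V))"
  have "c > 0" using b fin by (simp add: c_def)
  moreover have "c \<le> fract_norm (outer_weight G) (h F)" if "F \<in> \<F>" "h F \<noteq> 0" for F G
  proof -
    have "h F \<in> V" using that by (simp add: V_def)
    then show ?thesis using b[of "h F"] fin 
      by (smt (verit, best) Min_le c_def finite.insertI finite_imageI imageI insertCI)
  qed
  ultimately show ?thesis using that by blast
qed

text \<open>
  The quotient of a power of \<open>h\<close> by \<open>g\<close>, which is \<open>0\<close> wherever \<open>g\<close> is, specializes correctly from \<open>F\<close>
  to \<open>G\<close> for two different reasons.  If \<open>g G \<noteq> 0\<close>, then \<open>g F\<close> has norm \<open>1\<close> and division preserves
  congruences.  If \<open>g G = 0\<close>, then \<open>h G = 0\<close>, so the norm of \<open>h F\<close> is at most \<open>1/2\<close>; the exponent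
  is chosen so that the power of \<open>h F\<close> outweighs the smallest nonzero value of \<open>g\<close>.
\<close>
lemma sections_division:
  assumes h: "h \<in> sections \<F>" and g: "g \<in> sections \<F>"
    and sub: "\<forall>F\<in>\<F>. h F \<noteq> 0 \<longrightarrow> g F \<noteq> 0"
  shows "\<exists>n. \<exists>q\<in>sections \<F>. \<forall>F. h F ^ Suc n = q F * g F"
proof -
  obtain c where c: "c > 0" "\<And>F G. F \<in> \<F> \<Longrightarrow> g F \<noteq> 0 \<Longrightarrow> c \<le> fract_norm (outer_weight G) (g F)"
    using sections_lower_bound[OF g] by blast
  obtain n :: nat where "(1/2) ^ n < c"
    using real_arch_pow_inv[OF c(1), of "1/2"] by auto
  then have n: "(1/2) ^ Suc n \<le> 1/2 * c" by simp
  define p where "p = (\<lambda>F. h F ^ Suc n)"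
  have p: "p \<in> sections \<F>" unfolding p_def by (rule sections_power[OF h])
  define q where "q = (\<lambda>F. p F / g F)"
  obtain A where A: "finite A" "\<And>F G. F \<in> \<F> \<Longrightarrow> G \<in> \<F> \<Longrightarrow> F \<inter> A = G \<inter> A \<Longrightarrow> p F = p G"
    using sections_finite_support[OF p] by blast
  obtain B where B: "finite B" "\<And>F G. F \<in> \<F> \<Longrightarrow> G \<in> \<F> \<Longrightarrow> F \<inter> B = G \<inter> B \<Longrightarrow> g F = g G"
    using sections_finite_support[OF g] by blast
  have "q \<in> sections \<F>"
  proof (rule sectionsI[where A = "A \<union> B"])
    fix F G assume FG: "F \<in> \<F>" "G \<in> \<F>"
    show "q F = q G" if "F \<inter> (A \<union> B) = G \<inter> (A \<union> B)"
    proof -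
      have "F \<inter> A = G \<inter> A" "F \<inter> B = G \<inter> B" using that by blast+
      then show ?thesis using A(2) B(2) FG unfolding q_def by metis
    qed
    show "fract_norm (outer_weight G) (q F - q G) \<le> 1/2" if "G \<subseteq> F"
    proof (cases "g G = 0")
      case False
      have gF: "g F \<noteq> 0" by (rule sections_generization[OF g FG that False])
      have 1: "fract_norm (outer_weight G) ((p F - p G) * g G) \<le> 1/2 * 1"
        unfolding outer_weight.fract_norm_mult
        using sections_specialize[OF p FG that] sections_fract_norm_le_1[OF g FG(2,2)]
        by (intro mult_mono outer_weight.fract_norm_nonneg) auto
      have 2: "fract_norm (outer_weight G) (p G * (g F - g G)) \<le> 1 * (1/2)"
        unfolding outer_weight.fract_norm_mult
        using sections_specialize[OF g FG that] sections_fract_norm_le_1[OF p FG(2,2)]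
        by (intro mult_mono outer_weight.fract_norm_nonneg) auto
      have "q F - q G = ((p F - p G) * g G - p G * (g F - g G)) / (g F * g G)"
        using gF False by (simp add: q_def field_simps)
      then have "fract_norm (outer_weight G) (q F - q G) = fract_norm (outer_weight G) ((p F - p G) * g G - p G * (g F - g G))"
        using sections_unit_at[OF g FG that False] outer_weight.fract_norm_weight_zero_field[OF sections_weight_zero_field[OF g FG(2)] False]
        by (simp add: outer_weight.fract_norm_divide outer_weight.fract_norm_mult)
      also have "\<dots> \<le> 1/2"
        using outer_weight.fract_norm_diff[of G "(p F - p G) * g G" "p G * (g F - g G)"] 1 2 by linarith
      finally show ?thesis .
    next
      case True
      then have hG: "h G = 0" using sub FG(2) by blast
      show ?thesis
      proof (cases "g F = 0")
        case True
        then show ?thesis using \<open>g G = 0\<close> by (simp add: q_def)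
      next
        case False
        have "fract_norm (outer_weight G) (q F - q G) = fract_norm (outer_weight G) (h F) ^ Suc n / fract_norm (outer_weight G) (g F)"
          by (simp add: q_def \<open>g G = 0\<close> p_def outer_weight.fract_norm_divide outer_weight.fract_norm_power outer_weight.fract_norm_mult)
        also have "\<dots> \<le> (1/2) ^ Suc n / fract_norm (outer_weight G) (g F)"
          using sections_specialize[OF h FG that] hG
          by (intro divide_right_mono power_mono outer_weight.fract_norm_nonneg) auto
        also have "\<dots> \<le> (1/2) ^ Suc n / c"
          using c(1) c(2)[OF FG(1) False, of G] by (intro divide_left_mono) auto
        also have "\<dots> \<le> 1/2" using n c(1) by (simp add: field_simps)
        finally show ?thesis .
      qed
    qed
  qed (use A(1) B(1) p g in \<open>auto simp: q_def sections_outside sections_weight_zero_field outer_weight.weight_zero_field_divide\<close>)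
  moreover have "h F ^ Suc n = q F * g F" for F
  proof (cases "g F = 0")
    case True
    then have "h F = 0" using sub sections_outside[OF h] by blast
    then show ?thesis using True by simp
  next
    case False
    then show ?thesis by (simp add: q_def p_def)
  qed
  ultimately show ?thesis by blast
qed

section \<open>The spectrum of the ring of sections\<close>

text \<open>
  For finite \<open>B\<close>, a section whose support is the basic open set \<open>{F. B \<subseteq> F}\<close>.
\<close>
definition monomial_section :: "'i::linorder set set \<Rightarrow> 'i set \<Rightarrow> 'i set \<Rightarrow> 'i ratfun" where
  "monomial_section \<F> B = (\<lambda>F. if F \<in> \<F> \<and> B \<subseteq> F then sqfree_monomial B else 0)"

lemma sqfree_monomial_nonzero: "finite B \<Longrightarrow> sqfree_monomial B \<noteq> 0"
  using fract_norm_sqfree_monomial[of B UNIV] by (metis outer_weight.fract_norm_zero power_not_zero zero_neq_one divide_eq_0_iff zero_neq_numeral)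

lemma monomial_section_sections:
  assumes "finite B"
  shows "monomial_section \<F> B \<in> sections \<F>"
proof (rule sectionsI[where A = B])
  fix F G assume FG: "F \<in> \<F>" "G \<in> \<F>"
  show "monomial_section \<F> B F = monomial_section \<F> B G" if "F \<inter> B = G \<inter> B"
    using that FG unfolding monomial_section_def by (metis inf.absorb_iff2)
  show "fract_norm (outer_weight G) (monomial_section \<F> B F - monomial_section \<F> B G) \<le> 1/2" if "G \<subseteq> F"
  proof (cases "B \<subseteq> F \<and> \<not> B \<subseteq> G")
    case True
    then have "card (B - G) \<noteq> 0" using assms by auto
    then have "(1/2::real) ^ card (B - G) \<le> (1/2) ^ 1" by (intro power_decreasing) auto
    then show ?thesis using True FG assms by (simp add: monomial_section_def fract_norm_sqfree_monomial)
  next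
    case False
    then show ?thesis using that FG by (auto simp: monomial_section_def)
  qed
qed (use assms in \<open>auto simp: monomial_section_def sqfree_monomial_weight_zero_field outer_weight.weight_zero_field_0\<close>)

definition vanishing :: "'i::linorder set set \<Rightarrow> 'i set \<Rightarrow> ('i set \<Rightarrow> 'i ratfun) set" where
  "vanishing \<F> F = {h \<in> sections \<F>. h F = 0}"

lemma vanishing_prime:
  assumes "F \<in> \<F>"
  shows "vanishing \<F> F \<in> Spec (section_ring \<F>)"
proof -
  interpret cring "section_ring \<F>" by (rule cring_section_ring)
  have uminus: "\<ominus>\<^bsub>section_ring \<F>\<^esub> f = (\<lambda>F. - f F)" if "f \<in> sections \<F>" for f
    using that by (intro minus_equality) (auto simp: sections_uminus)
  have "primeideal (vanishing \<F> F) (section_ring \<F>)"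
  proof (rule primeidealI2)
    show "additive_subgroup (vanishing \<F> F) (section_ring \<F>)"
      by (intro additive_subgroup.intro add.subgroupI)
        (auto simp: vanishing_def sections_add uminus sections_uminus intro: sections_zero)
    show "carrier (section_ring \<F>) \<noteq> vanishing \<F> F"
    proof
      assume "carrier (section_ring \<F>) = vanishing \<F> F"
      then have "(\<lambda>F. if F \<in> \<F> then 1 else 0) \<in> vanishing \<F> F"
        using sections_one[of \<F>] by simp
      then show False using assms by (simp add: vanishing_def)
    qed
  qed (auto simp: cring_section_ring vanishing_def sections_mult)
  then show ?thesis by (simp add: Spec_def)
qed

text \<open>
  Ordered by inclusion, a nonempty family of this kind is an algebraic lattice that may lack a largest
  element, and the topology with basis \<open>{F. B \<subseteq> F}\<close>, \<open>B\<close> finite, is its Scott topology.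
\<close>
locale algebraic_family =
  fixes \<F> :: "'i::linorder set set"
  assumes Inter_closed: "\<G> \<subseteq> \<F> \<Longrightarrow> \<G> \<noteq> {} \<Longrightarrow> \<Inter>\<G> \<in> \<F>"
    and finitary: "(\<And>B. finite B \<Longrightarrow> B \<subseteq> F \<Longrightarrow> \<exists>C\<in>\<F>. B \<subseteq> C \<and> C \<subseteq> F) \<Longrightarrow> F \<in> \<F>"
begin

abbreviation "R \<equiv> section_ring \<F>"

lemma least_member:
  assumes "F \<in> \<F>" "B \<subseteq> F"
  obtains C where "C \<in> \<F>" "B \<subseteq> C" "\<And>G. G \<in> \<F> \<Longrightarrow> B \<subseteq> G \<Longrightarrow> C \<subseteq> G"
proof
  show "\<Inter>{G \<in> \<F>. B \<subseteq> G} \<in> \<F>" by (rule Inter_closed) (use assms in auto)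
qed auto

text \<open>
  If \<open>h E \<noteq> 0\<close>, then \<open>h\<close> is also nonzero at the least member containing \<open>E \<inter> A\<close>, since this member
  has the same trace on \<open>A\<close>, and hence at all larger members.  So the traces on \<open>A\<close> of the points
  of the support generate it, and there are only finitely many of them.
\<close>
lemma support_finitely_generated:
  assumes h: "h \<in> sections \<F>"
  obtains \<B> where "finite \<B>" "\<And>B. B \<in> \<B> \<Longrightarrow> finite B"
    "\<And>F. F \<in> \<F> \<Longrightarrow> h F \<noteq> 0 \<longleftrightarrow> (\<exists>B\<in>\<B>. B \<subseteq> F)"
proof -
  obtain A where A: "finite A" "\<And>F G. F \<in> \<F> \<Longrightarrow> G \<in> \<F> \<Longrightarrow> F \<inter> A = G \<inter> A \<Longrightarrow> h F = h G"
    using sections_finite_support[OF h] by blast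
  define \<B> where "\<B> = (\<lambda>F. F \<inter> A) ` {F \<in> \<F>. h F \<noteq> 0}"
  have "\<B> \<subseteq> Pow A" by (auto simp: \<B>_def)
  then have "finite \<B>" "\<And>B. B \<in> \<B> \<Longrightarrow> finite B"
    using A(1) by (auto intro: finite_subset)
  moreover have "h F \<noteq> 0 \<longleftrightarrow> (\<exists>B\<in>\<B>. B \<subseteq> F)" if F: "F \<in> \<F>" for F
  proof
    assume "h F \<noteq> 0"
    then show "\<exists>B\<in>\<B>. B \<subseteq> F" using F by (auto simp: \<B>_def)
  next
    assume "\<exists>B\<in>\<B>. B \<subseteq> F"
    then obtain E where E: "E \<in> \<F>" "h E \<noteq> 0" "E \<inter> A \<subseteq> F" by (auto simp: \<B>_def)
    obtain C where C: "C \<in> \<F>" "E \<inter> A \<subseteq> C" "\<And>G. G \<in> \<F> \<Longrightarrow> E \<inter> A \<subseteq> G \<Longrightarrow> C \<subseteq> G"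
      using least_member[OF F E(3)] by blast
    have "C \<subseteq> E" using C(3) E(1) by blast
    then have "C \<inter> A = E \<inter> A" using C(2) by blast
    then have "h C \<noteq> 0" using A(2) C(1) E(1,2) by metis
    then show "h F \<noteq> 0" by (rule sections_generization[OF h F C(1) C(3)[OF F E(3)]])
  qed
  ultimately show ?thesis using that by blast
qed

lemma prime_contains_power:
  assumes P: "primeideal P R" and h: "h \<in> sections \<F>" and "(\<lambda>F. h F ^ Suc n) \<in> P"
  shows "h \<in> P"
  using assms(3)
proof (induction n)
  case (Suc n)
  have "h \<otimes>\<^bsub>R\<^esub> (\<lambda>F. h F ^ Suc n) \<in> P" using Suc.prems by simp
  then have "h \<in> P \<or> (\<lambda>F. h F ^ Suc n) \<in> P"
    using primeideal.I_prime[OF P, of h "\<lambda>F. h F ^ Suc n"] h sections_power[OF h, of n] by simp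
  then show ?case using Suc.IH by blast
qed simp

text \<open>
  A power of \<open>h\<close> is a multiple of \<open>g\<close>.
\<close>
lemma prime_support_mono:
  assumes P: "primeideal P R" and h: "h \<in> sections \<F>" and g: "g \<in> P"
    and sub: "\<And>F. F \<in> \<F> \<Longrightarrow> h F \<noteq> 0 \<Longrightarrow> g F \<noteq> 0"
  shows "h \<in> P"
proof -
  interpret P: primeideal P R by (rule P)
  have "g \<in> sections \<F>" using P.a_subset g by auto
  then obtain n q where q: "q \<in> sections \<F>" "\<forall>F. h F ^ Suc n = q F * g F"
    using sections_division[of h \<F> g] h sub by blast
  have "q \<otimes>\<^bsub>R\<^esub> g \<in> P" using P.I_l_closed[OF g, of q] q(1) by simp
  moreover have "q \<otimes>\<^bsub>R\<^esub> g = (\<lambda>F. h F ^ Suc n)" using q(2) by auto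
  ultimately have "(\<lambda>F. h F ^ Suc n) \<in> P" by simp
  then show ?thesis by (rule prime_contains_power[OF P h])
qed

text \<open>
  The point is the set \<open>F\<close> of all \<open>i\<close> whose \<open>X\<^sub>i\<close>, extended by \<open>0\<close>, lies outside \<open>P\<close>.  A finite \<open>B \<subseteq> F\<close> has its monomial
  outside \<open>P\<close>; so this monomial is not zero, \<open>B\<close> has a least member \<open>C\<close> above it, and \<open>C \<subseteq> F\<close>
  because the support of the monomial lies in that of \<open>X\<^sub>i\<close> for each \<open>i \<in> C\<close>.  This is what
  \<open>F \<in> \<F>\<close> requires.
\<close>
lemma prime_is_vanishing:
  assumes "primeideal P R"
  obtains F where "F \<in> \<F>" "P = vanishing \<F> F"
proof -
  interpret P: primeideal P R by (rule assms)
  have Psub: "P \<subseteq> sections \<F>" using P.a_subset by simp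
  have zero: "(\<lambda>F. 0) \<in> P" using P.additive_subgroup_axioms additive_subgroup.zero_closed by fastforce
  define F where "F = {i. monomial_section \<F> {i} \<notin> P}"
  have iff: "monomial_section \<F> B \<notin> P \<longleftrightarrow> B \<subseteq> F" if "finite B" for B
    using that
  proof (induction B)
    case empty
    have "monomial_section \<F> {} = \<one>\<^bsub>R\<^esub>" by (auto simp: monomial_section_def sqfree_monomial_empty)
    then show ?case using P.one_imp_carrier P.I_notcarr by auto
  next
    case (insert i B)
    have eq: "monomial_section \<F> (insert i B) = monomial_section \<F> {i} \<otimes>\<^bsub>R\<^esub> monomial_section \<F> B"
      using sqfree_monomial_insert[OF insert.hyps] by (auto simp: monomial_section_def)
    have "monomial_section \<F> (insert i B) \<in> P \<longleftrightarrow> monomial_section \<F> {i} \<in> P \<or> monomial_section \<F> B \<in> P"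
      unfolding eq
      using P.I_prime[of "monomial_section \<F> {i}" "monomial_section \<F> B"] P.I_l_closed[of "monomial_section \<F> B" "monomial_section \<F> {i}"]
        P.I_r_closed[of "monomial_section \<F> {i}" "monomial_section \<F> B"] insert.hyps(1)
      by (auto simp: monomial_section_sections)
    then show ?case using insert.IH by (auto simp: F_def)
  qed
  have "F \<in> \<F>"
  proof (rule finitary)
    fix B assume B: "finite B" "B \<subseteq> F"
    then have BP: "monomial_section \<F> B \<notin> P" using iff by blast
    then have "monomial_section \<F> B \<noteq> (\<lambda>F. 0)" using zero by metis
    then obtain E where E: "E \<in> \<F>" "B \<subseteq> E" by (auto simp: monomial_section_def fun_eq_iff split: if_splits)
    obtain C where C: "C \<in> \<F>" "B \<subseteq> C" "\<And>G. G \<in> \<F> \<Longrightarrow> B \<subseteq> G \<Longrightarrow> C \<subseteq> G"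
      using least_member[OF E] by blast
    have "i \<in> F" if "i \<in> C" for i
    proof -
      have "monomial_section \<F> {i} G \<noteq> 0" if "G \<in> \<F>" "monomial_section \<F> B G \<noteq> 0" for G
        using that C(3)[of G] \<open>i \<in> C\<close> sqfree_monomial_nonzero[of "{i}"] by (auto simp: monomial_section_def split: if_splits)
      then have "monomial_section \<F> {i} \<notin> P"
        using prime_support_mono[OF assms monomial_section_sections[OF B(1)]] BP by blast
      then show ?thesis by (simp add: F_def)
    qed
    then show "\<exists>C\<in>\<F>. B \<subseteq> C \<and> C \<subseteq> F" using C by blast
  qed
  moreover have "h \<in> P \<longleftrightarrow> h F = 0" if h: "h \<in> sections \<F>" for h
  proof -
    obtain \<B> where \<B>: "finite \<B>" "\<And>B. B \<in> \<B> \<Longrightarrow> finite B"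
      "\<And>F. F \<in> \<F> \<Longrightarrow> h F \<noteq> 0 \<longleftrightarrow> (\<exists>B\<in>\<B>. B \<subseteq> F)"
      using support_finitely_generated[OF h] by blast
    show ?thesis
    proof
      assume hP: "h \<in> P"
      show "h F = 0"
      proof (rule ccontr)
        assume "h F \<noteq> 0"
        then obtain B where B: "B \<in> \<B>" "B \<subseteq> F" using \<B>(3) \<open>F \<in> \<F>\<close> by blast
        have "monomial_section \<F> B \<in> P"
          by (rule prime_support_mono[OF assms monomial_section_sections hP])
            (use B \<B> in \<open>auto simp: monomial_section_def split: if_splits\<close>)
        then show False using iff[of B] B \<B>(2) by blast
      qed
    next
      assume "h F = 0"
      then have BP: "monomial_section \<F> B \<in> P" if "B \<in> \<B>" for B
        using iff[of B] \<B>(2,3) \<open>F \<in> \<F>\<close> that by blast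
      \<comment> \<open>\<open>g \<B>\<close> is a sum of distinct monomials with the same support as \<open>h\<close>.\<close>
      define g where "g = (\<lambda>\<C> G. \<Sum>B\<in>\<C>. monomial_section \<F> B G)"
      have "g \<C> \<in> P" if "\<C> \<subseteq> \<B>" for \<C>
        using finite_subset[OF that \<B>(1)] that
      proof (induction \<C>)
        case empty
        then show ?case using zero by (simp add: g_def)
      next
        case (insert B \<C>)
        have "g (insert B \<C>) = monomial_section \<F> B \<oplus>\<^bsub>R\<^esub> g \<C>"
          using insert.hyps by (simp add: g_def)
        then show ?case using additive_subgroup.a_closed[OF P.additive_subgroup_axioms, of "monomial_section \<F> B" "g \<C>"] BP insert by simp
      qed
      then have gP: "g \<B> \<in> P" by blast
      have "g \<B> G \<noteq> 0" if G: "G \<in> \<F>" "h G \<noteq> 0" for G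
      proof -
        have "g \<B> G = (\<Sum>B\<in>{B \<in> \<B>. B \<subseteq> G}. sqfree_monomial B)"
          using G \<B>(1) by (simp add: g_def monomial_section_def sum.inter_filter)
        also have "\<dots> \<noteq> 0"
          by (rule sum_sqfree_monomial_nonzero) (use \<B> G in auto)
        finally show ?thesis .
      qed
      then show "h \<in> P" by (rule prime_support_mono[OF assms h gP])
    qed
  qed
  then have "P = vanishing \<F> F" using Psub by (auto simp: vanishing_def)
  ultimately show ?thesis using that by blast
qed

lemma vanishing_inj: "inj_on (vanishing \<F>) \<F>"
proof (rule inj_onI)
  have *: "F \<subseteq> G" if "F \<in> \<F>" "G \<in> \<F>" "vanishing \<F> F = vanishing \<F> G" for F G
  proof
    fix i assume "i \<in> F"
    then have "monomial_section \<F> {i} \<notin> vanishing \<F> F"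
      using that(1) sqfree_monomial_nonzero[of "{i}"] by (simp add: vanishing_def monomial_section_def)
    then have "monomial_section \<F> {i} \<notin> vanishing \<F> G" using that(3) by blast
    then have "monomial_section \<F> {i} G \<noteq> 0" using monomial_section_sections[of "{i}" \<F>] by (simp add: vanishing_def)
    then show "i \<in> G" by (auto simp: monomial_section_def split: if_splits)
  qed
  fix F G assume "F \<in> \<F>" "G \<in> \<F>" "vanishing \<F> F = vanishing \<F> G"
  then show "F = G" using *[of F G] *[of G F] by blast
qed

lemma Spec_section_ring: "Spec R = vanishing \<F> ` \<F>"
  using vanishing_prime prime_is_vanishing by (fastforce simp: Spec_def)

end

lemma openin_spec_topology_iff:
  assumes "cring R"
  shows "openin (spec_topology R) U \<longleftrightarrow> U \<subseteq> Spec R \<and>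
    (\<forall>P\<in>U. \<exists>a\<in>carrier R. a \<notin> P \<and> (\<forall>Q\<in>Spec R. a \<notin> Q \<longrightarrow> Q \<in> U))"
proof
  assume "openin (spec_topology R) U"
  then obtain A where A: "A \<subseteq> carrier R" "U = Spec R - {P \<in> Spec R. A \<subseteq> P}"
    unfolding openin_spec_topology[OF assms] by (elim exE conjE)
  show "U \<subseteq> Spec R \<and> (\<forall>P\<in>U. \<exists>a\<in>carrier R. a \<notin> P \<and> (\<forall>Q\<in>Spec R. a \<notin> Q \<longrightarrow> Q \<in> U))"
  proof (intro conjI ballI)
    show "U \<subseteq> Spec R" using A(2) by blast
    fix P assume "P \<in> U"
    then obtain a where "a \<in> A" "a \<notin> P" using A(2) by blast
    moreover from this have "Q \<in> U" if "Q \<in> Spec R" "a \<notin> Q" for Q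
      using A(2) that by blast
    ultimately show "\<exists>a\<in>carrier R. a \<notin> P \<and> (\<forall>Q\<in>Spec R. a \<notin> Q \<longrightarrow> Q \<in> U)"
      using A(1) by blast
  qed
next
  assume U: "U \<subseteq> Spec R \<and> (\<forall>P\<in>U. \<exists>a\<in>carrier R. a \<notin> P \<and> (\<forall>Q\<in>Spec R. a \<notin> Q \<longrightarrow> Q \<in> U))"
  define A where "A = {a \<in> carrier R. \<forall>Q\<in>Spec R. a \<notin> Q \<longrightarrow> Q \<in> U}"
  have "P \<in> U \<longleftrightarrow> P \<in> Spec R \<and> \<not> A \<subseteq> P" for P
  proof
    assume "P \<in> U"
    with U obtain a where "a \<in> carrier R" "a \<notin> P" "\<forall>Q\<in>Spec R. a \<notin> Q \<longrightarrow> Q \<in> U" by meson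
    then have "a \<in> A" "a \<notin> P" by (simp_all add: A_def)
    then show "P \<in> Spec R \<and> \<not> A \<subseteq> P" using U \<open>P \<in> U\<close> by blast
  next
    assume "P \<in> Spec R \<and> \<not> A \<subseteq> P"
    then show "P \<in> U" by (auto simp: A_def)
  qed
  then have "U = Spec R - {P \<in> Spec R. A \<subseteq> P}" by blast
  then show "openin (spec_topology R) U"
    unfolding openin_spec_topology[OF assms] using A_def by blast
qed

lemma homeomorphic_map_by_open:
  assumes "bij_betw f (topspace X) (topspace Y)"
    and "\<And>U. U \<subseteq> topspace X \<Longrightarrow> openin X U \<longleftrightarrow> openin Y (f ` U)"
  shows "homeomorphic_map X Y f"
proof (rule bijective_open_imp_homeomorphic_map)
  show "open_map X Y f"
    unfolding open_map_def using assms(2) openin_subset by blast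
  show "f ` topspace X = topspace Y" "inj_on f (topspace X)"
    using assms(1) by (auto simp: bij_betw_def)
  show "continuous_map X Y f"
    unfolding continuous_map
  proof (intro conjI allI impI)
    show "f ` topspace X \<subseteq> topspace Y" using assms(1) by (simp add: bij_betw_def)
    fix V assume V: "openin Y V"
    have "f ` {x \<in> topspace X. f x \<in> V} = V"
      using openin_subset[OF V] assms(1) by (auto simp: bij_betw_def)
    then show "openin X {x \<in> topspace X. f x \<in> V}" using assms(2)[of "{x \<in> topspace X. f x \<in> V}"] V by auto
  qed
qed

lemma (in algebraic_family) homeomorphic_to_Spec:
  assumes bij: "bij_betw \<phi> (topspace X) \<F>"
    and top: "\<And>U. U \<subseteq> topspace X \<Longrightarrow> openin X U \<longleftrightarrow>
      (\<forall>x\<in>U. \<exists>B. finite B \<and> B \<subseteq> \<phi> x \<and> (\<forall>y\<in>topspace X. B \<subseteq> \<phi> y \<longrightarrow> y \<in> U))"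
  shows "X homeomorphic_space spec_topology R"
proof -
  define f where "f = (\<lambda>x. vanishing \<F> (\<phi> x))"
  have fx: "f ` topspace X = Spec R" "inj_on f (topspace X)"
    using bij vanishing_inj unfolding Spec_section_ring f_def
    by (auto simp: bij_betw_def inj_on_def)
  have phi: "\<phi> x \<in> \<F>" if "x \<in> topspace X" for x using bij that by (auto simp: bij_betw_def)
  have "openin X U \<longleftrightarrow> openin (spec_topology R) (f ` U)" if U: "U \<subseteq> topspace X" for U
  proof -
    have mem: "f y \<in> f ` U \<longleftrightarrow> y \<in> U" if "y \<in> topspace X" for y
      using fx(2) U that by (auto simp: inj_on_def)
    have notin: "a \<notin> f y \<longleftrightarrow> a (\<phi> y) \<noteq> 0" if "a \<in> sections \<F>" for a y
      using that by (auto simp: f_def vanishing_def)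
    have "openin (spec_topology R) (f ` U) \<longleftrightarrow>
      (\<forall>x\<in>U. \<exists>a\<in>sections \<F>. a \<notin> f x \<and> (\<forall>y\<in>topspace X. a \<notin> f y \<longrightarrow> f y \<in> f ` U))"
      unfolding openin_spec_topology_iff[OF cring_section_ring] fx(1)[symmetric] using U by auto
    also have "\<dots> \<longleftrightarrow> (\<forall>x\<in>U. \<exists>a\<in>sections \<F>. a (\<phi> x) \<noteq> 0 \<and> (\<forall>y\<in>topspace X. a (\<phi> y) \<noteq> 0 \<longrightarrow> y \<in> U))"
      by (simp add: notin mem cong: bex_cong)
    also have "\<dots> \<longleftrightarrow> (\<forall>x\<in>U. \<exists>B. finite B \<and> B \<subseteq> \<phi> x \<and> (\<forall>y\<in>topspace X. B \<subseteq> \<phi> y \<longrightarrow> y \<in> U))"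
    proof (intro ball_cong refl iffI)
      fix x assume x: "x \<in> U" and "\<exists>a\<in>sections \<F>. a (\<phi> x) \<noteq> 0 \<and> (\<forall>y\<in>topspace X. a (\<phi> y) \<noteq> 0 \<longrightarrow> y \<in> U)"
      then obtain a where a: "a \<in> sections \<F>" "a (\<phi> x) \<noteq> 0" "\<And>y. y \<in> topspace X \<Longrightarrow> a (\<phi> y) \<noteq> 0 \<Longrightarrow> y \<in> U"
        by blast
      obtain \<B> where \<B>: "finite \<B>" "\<And>B. B \<in> \<B> \<Longrightarrow> finite B"
        "\<And>F. F \<in> \<F> \<Longrightarrow> a F \<noteq> 0 \<longleftrightarrow> (\<exists>B\<in>\<B>. B \<subseteq> F)"
        using support_finitely_generated[OF a(1)] by blast
      obtain B where B: "B \<in> \<B>" "B \<subseteq> \<phi> x" using \<B>(3)[of "\<phi> x"] phi[of x] a(2) x U by blast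
      have "y \<in> U" if "y \<in> topspace X" "B \<subseteq> \<phi> y" for y
        using a(3)[OF that(1)] \<B>(3)[OF phi[OF that(1)]] B(1) that(2) by blast
      then show "\<exists>B. finite B \<and> B \<subseteq> \<phi> x \<and> (\<forall>y\<in>topspace X. B \<subseteq> \<phi> y \<longrightarrow> y \<in> U)"
        using B \<B>(2) by blast
    next
      fix x assume x: "x \<in> U" and "\<exists>B. finite B \<and> B \<subseteq> \<phi> x \<and> (\<forall>y\<in>topspace X. B \<subseteq> \<phi> y \<longrightarrow> y \<in> U)"
      then obtain B where B: "finite B" "B \<subseteq> \<phi> x" "\<And>y. y \<in> topspace X \<Longrightarrow> B \<subseteq> \<phi> y \<Longrightarrow> y \<in> U"
        by blast
      have "monomial_section \<F> B (\<phi> y) \<noteq> 0 \<longleftrightarrow> B \<subseteq> \<phi> y" if "y \<in> topspace X" for y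
        using phi[OF that] sqfree_monomial_nonzero[OF B(1)] by (simp add: monomial_section_def)
      then show "\<exists>a\<in>sections \<F>. a (\<phi> x) \<noteq> 0 \<and> (\<forall>y\<in>topspace X. a (\<phi> y) \<noteq> 0 \<longrightarrow> y \<in> U)"
        using B x U by (intro bexI[of _ "monomial_section \<F> B"] monomial_section_sections) auto
    qed
    finally show ?thesis using top[OF U] by blast
  qed
  then have "homeomorphic_map X (spec_topology R) f"
    using fx by (intro homeomorphic_map_by_open) 
      (auto simp: bij_betw_def topspace_spec_topology cring_section_ring)
  then show ?thesis by (rule homeomorphic_map_imp_homeomorphic_space)
qed

section \<open>A linearly ordered copy of a type\<close>

text \<open>
  That polynomials have no zero divisors is proved with a linear order on the indeterminates.
  A copy of the type is used because the order, obtained from the well-ordering theorem, must not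
  clash with an order that the type itself may carry.
\<close>
datatype 'a wo = Wo (unWo: 'a)

definition wo_rel :: "'a wo rel" where
  "wo_rel = (SOME r. linear_order_on UNIV r)"

lemma linear_order_wo_rel: "linear_order_on UNIV wo_rel"
  unfolding wo_rel_def using well_order_on[of UNIV]
  by (metis (mono_tags) someI_ex well_order_on_def)

instantiation wo :: (type) linorder
begin

definition less_eq_wo :: "'a wo \<Rightarrow> 'a wo \<Rightarrow> bool" where
  "x \<le> y \<longleftrightarrow> (x, y) \<in> wo_rel"

definition less_wo :: "'a wo \<Rightarrow> 'a wo \<Rightarrow> bool" where
  "x < y \<longleftrightarrow> x \<le> y \<and> \<not> y \<le> (x :: 'a wo)"

instance
proof
  have lin: "refl (wo_rel :: 'a wo rel)" "trans (wo_rel :: 'a wo rel)"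
    "antisym (wo_rel :: 'a wo rel)" "total (wo_rel :: 'a wo rel)"
    using linear_order_wo_rel[where 'a = 'a]
    by (auto simp: linear_order_on_def partial_order_on_def preorder_on_def)
  fix x y z :: "'a wo"
  show "(x < y) = (x \<le> y \<and> \<not> y \<le> x)" by (rule less_wo_def)
  show "x \<le> x" using lin(1) by (simp add: less_eq_wo_def refl_on_def)
  show "x \<le> z" if "x \<le> y" "y \<le> z" using that lin(2) by (auto simp: less_eq_wo_def dest: transD)
  show "x = y" if "x \<le> y" "y \<le> x" using that lin(3) by (auto simp: less_eq_wo_def dest: antisymD)
  show "x \<le> y \<or> y \<le> x"
    using lin(1,4) by (cases "x = y") (auto simp: less_eq_wo_def total_on_def refl_on_def)
qed

end

section \<open>Bounding the number of rational functions and sections\<close>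

lemma times_lepoll_infinite:
  assumes "infinite C" "A \<lesssim> C" "B \<lesssim> C"
  shows "A \<times> B \<lesssim> C"
proof -
  have "C \<times> C \<approx> C"
    unfolding eqpoll_iff_card_of_ordIso by (rule card_of_Times_same_infinite[OF assms(1)])
  then show ?thesis using times_lepoll_mono[OF assms(2,3)] lepoll_trans2 by blast
qed

lemma poly_mapping_lepoll:
  assumes "infinite C" "(UNIV :: 'k set) \<lesssim> C" "(UNIV :: 'v::zero set) \<lesssim> C"
  shows "(UNIV :: ('k \<Rightarrow>\<^sub>0 'v) set) \<lesssim> C"
proof -
  let ?g = "\<lambda>f :: 'k \<Rightarrow>\<^sub>0 'v. (\<lambda>k. (k, Poly_Mapping.lookup f k)) ` Poly_Mapping.keys f"
  have "inj ?g"
  proof (rule injI)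
    fix f h :: "'k \<Rightarrow>\<^sub>0 'v" assume eq: "?g f = ?g h"
    have *: "(k, v) \<in> ?g p \<longleftrightarrow> v \<noteq> 0 \<and> Poly_Mapping.lookup p k = v" for k v p
      by (auto simp: in_keys_iff)
    have "v \<noteq> 0 \<and> Poly_Mapping.lookup f k = v \<longleftrightarrow> v \<noteq> 0 \<and> Poly_Mapping.lookup h k = v" for k v
      using eq * by metis
    then show "f = h" by (intro poly_mapping_eqI) metis
  qed
  moreover have "range ?g \<subseteq> Fpow UNIV" by (auto simp: Fpow_def)
  ultimately have "(UNIV :: ('k \<Rightarrow>\<^sub>0 'v) set) \<lesssim> Fpow (UNIV :: ('k \<times> 'v) set)"
    unfolding lepoll_def by blast
  also have "Fpow (UNIV :: ('k \<times> 'v) set) \<lesssim> Fpow C"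
  proof -
    have "(UNIV :: ('k \<times> 'v) set) \<lesssim> C"
      using times_lepoll_infinite[OF assms] by simp
    then obtain e :: "'k \<times> 'v \<Rightarrow> _" where "inj e" "range e \<subseteq> C" unfolding lepoll_def by blast
    then show ?thesis
      unfolding lepoll_def using inj_on_image_Fpow[of e UNIV] image_Fpow_mono[of e UNIV C] by blast
  qed
  also have "Fpow C \<approx> C" by (rule eqpoll_Fpow[OF assms(1)])
  finally show ?thesis .
qed

lemma ratfun_lepoll:
  assumes "infinite C" "(UNIV :: 'i::linorder set) \<lesssim> C"
  shows "(UNIV :: 'i ratfun set) \<lesssim> C"
proof -
  have nat: "(UNIV :: nat set) \<lesssim> C" using assms(1) by (simp add: infinite_le_lepoll)
  have "(UNIV :: int set) \<lesssim> (UNIV :: nat set)"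
    unfolding lepoll_def by (intro exI[of _ to_nat]) simp
  then have int: "(UNIV :: int set) \<lesssim> C" using nat by (rule lepoll_trans)
  have poly: "(UNIV :: (('i \<Rightarrow>\<^sub>0 nat) \<Rightarrow>\<^sub>0 int) set) \<lesssim> C"
    by (intro poly_mapping_lepoll assms nat int)
  have "(UNIV :: 'i ratfun set) \<subseteq> (\<lambda>(a, b). Fract a b) ` (UNIV \<times> UNIV)"
    by (auto simp: image_iff) (metis Fract_cases)
  then have "(UNIV :: 'i ratfun set) \<lesssim> (UNIV :: (('i \<Rightarrow>\<^sub>0 nat) \<Rightarrow>\<^sub>0 int) set) \<times> (UNIV :: (('i \<Rightarrow>\<^sub>0 nat) \<Rightarrow>\<^sub>0 int) set)"
    unfolding lepoll_iff by blast
  also have "\<dots> \<lesssim> C" by (rule times_lepoll_infinite[OF assms(1) poly poly])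
  finally show ?thesis .
qed

text \<open>
  A function is coded by its graph.
\<close>
lemma functions_lepoll_Pow:
  assumes "infinite C" "(UNIV :: 'x set) \<lesssim> C" "(UNIV :: 'y set) \<lesssim> C"
  shows "(UNIV :: ('x \<Rightarrow> 'y) set) \<lesssim> Pow C"
proof -
  have "(UNIV :: ('x \<times> 'y) set) \<lesssim> C"
    using times_lepoll_infinite[OF assms] by simp
  then obtain e :: "'x \<times> 'y \<Rightarrow> _" where e: "inj e" "range e \<subseteq> C" unfolding lepoll_def by blast
  have "inj (\<lambda>f. e ` range (\<lambda>x. (x, f x)))"
  proof (rule injI)
    fix f g :: "'x \<Rightarrow> 'y"
    assume "e ` range (\<lambda>x. (x, f x)) = e ` range (\<lambda>x. (x, g x))"
    then have "range (\<lambda>x. (x, f x)) = range (\<lambda>x. (x, g x))" using e(1) by (simp add: inj_image_eq_iff)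
    then show "f = g" by (auto simp: fun_eq_iff set_eq_iff image_iff)
  qed
  then show ?thesis
    unfolding lepoll_def using e(2) by (intro exI[of _ "\<lambda>f. e ` range (\<lambda>x. (x, f x))"]) auto
qed

section \<open>Moving a ring into a given type\<close>

lemma prime_vimage_iso:
  assumes R: "cring R" and S: "cring S" and f: "f \<in> ring_iso R S" and Q: "Q \<in> Spec S"
  shows "{x \<in> carrier R. f x \<in> Q} \<in> Spec R"
proof -
  interpret R: cring R by fact
  interpret S: cring S by fact
  interpret Q: primeideal Q S using Q by (simp add: Spec_def)
  interpret f: ring_hom_ring R S f
    using f by (intro ring_hom_ringI2 R.ring_axioms S.ring_axioms) (simp add: ring_iso_def)
  have "primeideal {x \<in> carrier R. f x \<in> Q} R"
  proof (rule primeidealI)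
    show "ideal {x \<in> carrier R. f x \<in> Q} R" by (rule f.ideal_vimage[OF Q.ideal_axioms])
    show "carrier R \<noteq> {x \<in> carrier R. f x \<in> Q}"
    proof
      assume "carrier R = {x \<in> carrier R. f x \<in> Q}"
      then have "f \<one>\<^bsub>R\<^esub> \<in> Q" using R.one_closed by blast
      then show False using Q.I_notcarr Q.one_imp_carrier by simp
    qed
  qed (use Q.I_prime f.hom_closed in \<open>auto simp: R\<close>)
  then show ?thesis by (simp add: Spec_def)
qed

lemma Spec_subset_carrier:
  assumes "P \<in> Spec R"
  shows "P \<subseteq> carrier R"
proof -
  interpret primeideal P R using assms by (simp add: Spec_def)
  show ?thesis by (rule a_subset)
qed

lemma spec_topology_ring_iso:
  assumes R: "cring R" and S: "cring S" and f: "f \<in> ring_iso R S"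
  shows "spec_topology S homeomorphic_space spec_topology R"
proof -
  define g where "g = inv_into (carrier R) f"
  have g: "g \<in> ring_iso S R"
    unfolding g_def by (rule ring_iso_set_sym[OF _ f]) (use R in \<open>simp add: cring_def\<close>)
  have bij: "bij_betw f (carrier R) (carrier S)" using f by (simp add: ring_iso_def)
  have fg: "f (g y) = y" "g y \<in> carrier R" if "y \<in> carrier S" for y
    using that bij unfolding g_def by (auto simp: bij_betw_def f_inv_into_f inv_into_into)
  have gf: "g (f x) = x" "f x \<in> carrier S" if "x \<in> carrier R" for x
    using that bij unfolding g_def by (auto simp: bij_betw_def)
  define \<phi> where "\<phi> = (\<lambda>Q. {x \<in> carrier R. f x \<in> Q})"
  define \<psi> where "\<psi> = (\<lambda>P. {y \<in> carrier S. g y \<in> P})"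
  have bijphi: "bij_betw \<phi> (Spec S) (Spec R)"
  proof (rule bij_betw_byWitness[where f' = \<psi>])
    show "\<forall>Q\<in>Spec S. \<psi> (\<phi> Q) = Q" using Spec_subset_carrier[of _ S] fg by (fastforce simp: \<phi>_def \<psi>_def)
    show "\<forall>P\<in>Spec R. \<phi> (\<psi> P) = P" using Spec_subset_carrier[of _ R] gf by (fastforce simp: \<phi>_def \<psi>_def)
    show "\<phi> ` Spec S \<subseteq> Spec R" using prime_vimage_iso[OF R S f] by (auto simp: \<phi>_def)
    show "\<psi> ` Spec R \<subseteq> Spec S" using prime_vimage_iso[OF S R g] by (auto simp: \<psi>_def)
  qed
  have "homeomorphic_map (spec_topology S) (spec_topology R) \<phi>"
  proof (rule homeomorphic_map_by_open)
    show "bij_betw \<phi> (topspace (spec_topology S)) (topspace (spec_topology R))"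
      using bijphi by (simp add: topspace_spec_topology R S)
    fix U assume "U \<subseteq> topspace (spec_topology S)"
    then have U: "U \<subseteq> Spec S" by (simp add: topspace_spec_topology S)
    have mem: "\<phi> Q \<in> \<phi> ` U \<longleftrightarrow> Q \<in> U" if "Q \<in> Spec S" for Q
      using bijphi U that by (auto simp: bij_betw_def inj_on_def)
    have pre: "a \<in> \<phi> Q \<longleftrightarrow> f a \<in> Q" if "a \<in> carrier R" for a Q
      using that by (simp add: \<phi>_def)
    have img: "\<phi> ` Spec S = Spec R" using bijphi by (simp add: bij_betw_def)
    have "openin (spec_topology R) (\<phi> ` U) \<longleftrightarrow>
      (\<forall>Q\<in>U. \<exists>a\<in>carrier R. a \<notin> \<phi> Q \<and> (\<forall>Q'\<in>Spec S. a \<notin> \<phi> Q' \<longrightarrow> \<phi> Q' \<in> \<phi> ` U))"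
      using U unfolding openin_spec_topology_iff[OF R] by (simp add: img[symmetric] image_mono)
    also have "\<dots> \<longleftrightarrow> (\<forall>Q\<in>U. \<exists>a\<in>carrier R. f a \<notin> Q \<and> (\<forall>Q'\<in>Spec S. f a \<notin> Q' \<longrightarrow> Q' \<in> U))"
      by (simp add: mem pre cong: bex_cong)
    also have "\<dots> \<longleftrightarrow> (\<forall>Q\<in>U. \<exists>b\<in>f ` carrier R. b \<notin> Q \<and> (\<forall>Q'\<in>Spec S. b \<notin> Q' \<longrightarrow> Q' \<in> U))"
      by simp
    also have "\<dots> \<longleftrightarrow> openin (spec_topology S) U"
      unfolding openin_spec_topology_iff[OF S] using U bij by (simp add: bij_betw_def)
    finally show "openin (spec_topology S) U \<longleftrightarrow> openin (spec_topology R) (\<phi> ` U)" by blast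
  qed
  then show ?thesis by (rule homeomorphic_map_imp_homeomorphic_space)
qed

text \<open>
  Spectrality asks for a ring on one particular type; by transport of structure, the number of
  elements of the ring is all that matters.
\<close>
lemma spectral_space_transfer:
  fixes X :: "'x topology" and R :: "('c, 'd) ring_scheme"
  assumes R: "cring R" and X: "X homeomorphic_space spec_topology R"
    and card: "carrier R \<lesssim> (UNIV :: ('x + nat) set set)"
  shows "spectral_space X"
proof -
  obtain j :: "'c \<Rightarrow> ('x + nat) set" where j: "inj_on j (carrier R)"
    using card unfolding lepoll_def by blast
  interpret cring R by fact
  have iso: "j \<in> ring_iso R (image_ring j R)" by (rule inj_imp_image_ring_iso[OF j])
  have "cring (image_ring j R)"
    using ring_iso_imp_img_cring[OF iso] by (simp add: image_ring_def image_group_def monoid.defs)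
  then show ?thesis
    using spec_topology_ring_iso[OF R _ iso] X homeomorphic_space_trans homeomorphic_space_sym
    unfolding spectral_space_def by metis
qed

lemma (in algebraic_family) spectral_spaceI:
  fixes X :: "'x topology"
  assumes "bij_betw \<phi> (topspace X) \<F>"
    and "\<And>U. U \<subseteq> topspace X \<Longrightarrow> openin X U \<longleftrightarrow>
      (\<forall>x\<in>U. \<exists>B. finite B \<and> B \<subseteq> \<phi> x \<and> (\<forall>y\<in>topspace X. B \<subseteq> \<phi> y \<longrightarrow> y \<in> U))"
    and card: "(UNIV :: 'i set set) \<lesssim> (UNIV :: ('x + nat) set)"
  shows "spectral_space X"
proof (rule spectral_space_transfer)
  let ?C = "UNIV :: ('x + nat) set"
  have inf: "infinite ?C" by (simp add: finite_Plus_UNIV_iff)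
  have "(UNIV :: 'i set) \<lesssim> (UNIV :: 'i set set)" unfolding lepoll_def by (intro exI[of _ "\<lambda>i. {i}"]) simp
  then have "(UNIV :: 'i set) \<lesssim> ?C" using card by (rule lepoll_trans)
  then have "(UNIV :: ('i set \<Rightarrow> 'i ratfun) set) \<lesssim> Pow ?C"
    by (intro functions_lepoll_Pow inf card ratfun_lepoll)
  then show "carrier R \<lesssim> (UNIV :: ('x + nat) set set)"
    by (metis Pow_UNIV lepoll_trans subset_UNIV subset_imp_lepoll)
qed (use assms in \<open>auto intro: cring_section_ring homeomorphic_to_Spec\<close>)

section \<open>Quotient rings as saturated multiplicative sets\<close>

definition inverted :: "('a, 'm) ring_scheme \<Rightarrow> 'a set \<Rightarrow> 'a set \<Rightarrow> 'a set" where
  "inverted K D T = {s \<in> D - {\<zero>\<^bsub>K\<^esub>}. inv\<^bsub>K\<^esub> s \<in> T}"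

definition saturated :: "('a, 'm) ring_scheme \<Rightarrow> 'a set \<Rightarrow> 'a set \<Rightarrow> bool" where
  "saturated K D F \<longleftrightarrow> F \<subseteq> D - {\<zero>\<^bsub>K\<^esub>} \<and> \<one>\<^bsub>K\<^esub> \<in> F \<and>
     (\<forall>s\<in>D. \<forall>t\<in>D. s \<otimes>\<^bsub>K\<^esub> t \<in> F \<longleftrightarrow> s \<in> F \<and> t \<in> F)"

locale subdomain_of_field = field K for K :: "('a, 'm) ring_scheme" (structure) +
  fixes D :: "'a set"
  assumes subdomain: "subdomain D K"
begin

lemmas D_closed = subdomainE[OF subdomain]

lemma D_carrier: "a \<in> D \<Longrightarrow> a \<in> carrier K"
  using D_closed(1) by blast

lemma inv_in_carrier: "s \<in> D - {\<zero>} \<Longrightarrow> inv s \<in> carrier K"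
  and nonzero_r_inv: "s \<in> D - {\<zero>} \<Longrightarrow> s \<otimes> inv s = \<one>"
  using D_carrier field_Units by auto

lemma inv_of_product: "s \<in> D - {\<zero>} \<Longrightarrow> t \<in> D - {\<zero>} \<Longrightarrow> inv (s \<otimes> t) = inv s \<otimes> inv t"
proof -
  assume s: "s \<in> D - {\<zero>}" and t: "t \<in> D - {\<zero>}"
  note [simp] = inv_in_carrier[OF s] inv_in_carrier[OF t] D_carrier
  have "(s \<otimes> t) \<otimes> (inv s \<otimes> inv t) = (s \<otimes> inv s) \<otimes> (t \<otimes> inv t)"
    using s t by (simp add: m_ac)
  also have "\<dots> = \<one>" using s t by (simp add: nonzero_r_inv)
  finally show ?thesis using s t by (intro comm_inv_char) auto
qed

lemma saturatedD:
  assumes "saturated K D F"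
  shows "s \<in> F \<Longrightarrow> s \<in> D" "s \<in> F \<Longrightarrow> s \<noteq> \<zero>" "\<one> \<in> F"
    "s \<in> D \<Longrightarrow> t \<in> D \<Longrightarrow> s \<otimes> t \<in> F \<longleftrightarrow> s \<in> F \<and> t \<in> F"
  using assms by (auto simp: saturated_def)

text \<open>
  Saturation holds because \<open>1 / s = t / (s t)\<close> and \<open>T\<close> contains \<open>D\<close>.
\<close>
lemma saturated_inverted:
  assumes "T \<in> Over K D"
  shows "saturated K D (inverted K D T)"
proof -
  have T: "subring T K" "D \<subseteq> T" using assms by (auto simp: Over_def)
  note TE = subringE[OF T(1)]
  have "s \<otimes> t \<in> inverted K D T \<longleftrightarrow> s \<in> inverted K D T \<and> t \<in> inverted K D T"
    if st: "s \<in> D" "t \<in> D" for s t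
  proof (cases "s = \<zero> \<or> t = \<zero>")
    case True
    then show ?thesis using st D_carrier by (auto simp: inverted_def)
  next
    case False
    then have s: "s \<in> D - {\<zero>}" and t: "t \<in> D - {\<zero>}" using st by auto
    note [simp] = inv_in_carrier[OF s] inv_in_carrier[OF t] D_carrier
    have nz: "s \<otimes> t \<noteq> \<zero>" "s \<otimes> t \<in> D" using s t D_closed(6,9) by auto
    have "inv s = t \<otimes> (inv s \<otimes> inv t)"
      using st s t nonzero_r_inv[OF t] m_lcomm[of t "inv s" "inv t"] by simp
    moreover have "inv t = s \<otimes> (inv s \<otimes> inv t)"
      using st s t nonzero_r_inv[OF s] by (simp flip: m_assoc)
    ultimately have "inv s \<otimes> inv t \<in> T \<longleftrightarrow> inv s \<in> T \<and> inv t \<in> T"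
      using TE(6) T(2) st by (metis subsetD)
    then show ?thesis using s t nz inv_of_product[OF s t] by (simp add: inverted_def)
  qed
  moreover have "\<one> \<in> inverted K D T"
    using TE(3) D_closed(3) by (simp add: inverted_def)
  ultimately show ?thesis unfolding saturated_def by (auto simp: inverted_def)
qed

lemma subring_fractions:
  assumes S: "submonoid S K" "S \<subseteq> D" "\<zero> \<notin> S"
  shows "subring (fractions K S D) K"
proof (rule subringI)
  have SD: "s \<in> D - {\<zero>}" if "s \<in> S" for s using S(2,3) that by auto
  have one: "\<one> \<in> S" by (rule submonoid.one_closed[OF S(1)])
  show "fractions K S D \<subseteq> carrier K"
    using SD inv_in_carrier D_carrier by (auto simp: fractions_def)
  show "\<one> \<in> fractions K S D"
    unfolding fractions_def using one D_closed(3) by (intro CollectI exI[of _ \<one>]) simp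
  fix h assume "h \<in> fractions K S D"
  then obtain a s where h: "h = a \<otimes> inv s" "a \<in> D" "s \<in> S" by (auto simp: fractions_def)
  note [simp] = inv_in_carrier[OF SD[OF h(3)]] D_carrier[OF h(2)] D_carrier[of s]
  have sD: "s \<in> D" using SD h(3) by blast
  have "\<ominus> h = (\<ominus> a) \<otimes> inv s" using h by (simp add: l_minus)
  then show "\<ominus> h \<in> fractions K S D" using D_closed(5)[OF h(2)] h(3) by (auto simp: fractions_def)
  fix h' assume "h' \<in> fractions K S D"
  then obtain b t where h': "h' = b \<otimes> inv t" "b \<in> D" "t \<in> S" by (auto simp: fractions_def)
  note [simp] = inv_in_carrier[OF SD[OF h'(3)]] D_carrier[OF h'(2)] D_carrier[of t]
  have tD: "t \<in> D" using SD h'(3) by blast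
  have st: "s \<otimes> t \<in> S" using submonoid.m_closed[OF S(1)] h(3) h'(3) by blast
  have inv: "inv (s \<otimes> t) = inv s \<otimes> inv t" using inv_of_product SD h(3) h'(3) by blast
  have "h \<otimes> h' = (a \<otimes> b) \<otimes> inv (s \<otimes> t)"
    unfolding inv h h' by (simp add: m_ac)
  then show "h \<otimes> h' \<in> fractions K S D"
    using D_closed(6)[OF h(2) h'(2)] st by (auto simp: fractions_def)
  have "a \<otimes> t \<otimes> inv (s \<otimes> t) = (a \<otimes> inv s) \<otimes> (t \<otimes> inv t)"
    unfolding inv using tD sD by (simp add: m_ac)
  then have 1: "a \<otimes> t \<otimes> inv (s \<otimes> t) = h" using nonzero_r_inv[OF SD[OF h'(3)]] h by simp
  have "b \<otimes> s \<otimes> inv (s \<otimes> t) = (b \<otimes> inv t) \<otimes> (s \<otimes> inv s)"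
    unfolding inv using tD sD by (simp add: m_ac)
  then have 2: "b \<otimes> s \<otimes> inv (s \<otimes> t) = h'" using nonzero_r_inv[OF SD[OF h(3)]] h' by simp
  have "h \<oplus> h' = (a \<otimes> t \<oplus> b \<otimes> s) \<otimes> inv (s \<otimes> t)"
    using 1 2 sD tD by (simp add: l_distr inv)
  moreover have "a \<otimes> t \<oplus> b \<otimes> s \<in> D"
    using D_closed(6,7) h(2) h'(2) sD tD by blast
  ultimately show "h \<oplus> h' \<in> fractions K S D" using st by (auto simp: fractions_def)
qed

lemma fractions_inverted:
  assumes "T \<in> Over_qr K D"
  shows "fractions K (inverted K D T) D = T"
proof -
  obtain S where S: "submonoid S K" "S \<subseteq> D" "\<zero> \<notin> S" "T = fractions K S D"
    and T: "subring T K" "D \<subseteq> T"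
    using assms by (auto simp: Over_qr_def Over_def)
  have "S \<subseteq> inverted K D T"
  proof
    fix s assume s: "s \<in> S"
    then have "s \<in> D - {\<zero>}" using S(2,3) by blast
    moreover have "inv s \<in> T" unfolding S(4) fractions_def
      using s D_closed(3) inv_in_carrier[OF \<open>s \<in> D - {\<zero>}\<close>] by (intro CollectI exI[of _ \<one>] exI[of _ s]) simp
    ultimately show "s \<in> inverted K D T" by (simp add: inverted_def)
  qed
  then have "T \<subseteq> fractions K (inverted K D T) D" unfolding S(4) by (auto simp: fractions_def)
  moreover have "fractions K (inverted K D T) D \<subseteq> T"
    using T(2) subringE(6)[OF T(1)] by (auto simp: fractions_def inverted_def)
  ultimately show ?thesis by blast
qed

text \<open>
  If \<open>1 / u = a / s\<close> with \<open>s \<in> F\<close>, then \<open>s = a u\<close>, so \<open>u \<in> F\<close> by saturation.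
\<close>
lemma saturated_fractions:
  assumes F: "saturated K D F"
  shows "fractions K F D \<in> Over_qr K D" "inverted K D (fractions K F D) = F"
proof -
  note FD = saturatedD[OF F]
  have "submonoid F K"
    by (rule submonoid.intro) (use FD D_carrier in blast)+
  moreover have "F \<subseteq> D" "\<zero> \<notin> F" using FD by auto
  moreover have "D \<subseteq> fractions K F D"
  proof
    fix a assume "a \<in> D"
    then show "a \<in> fractions K F D" unfolding fractions_def
      using FD(3) D_carrier[of a] by (intro CollectI exI[of _ a] exI[of _ \<one>]) simp
  qed
  ultimately show "fractions K F D \<in> Over_qr K D"
    unfolding Over_qr_def Over_def using subring_fractions by blast
  show "inverted K D (fractions K F D) = F"
  proof
    show "F \<subseteq> inverted K D (fractions K F D)"
    proof
      fix s assume s: "s \<in> F"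
      then have "s \<in> D - {\<zero>}" using FD by blast
      moreover have "inv s \<in> fractions K F D" unfolding fractions_def
        using s D_closed(3) inv_in_carrier[OF \<open>s \<in> D - {\<zero>}\<close>] by (intro CollectI exI[of _ \<one>] exI[of _ s]) simp
      ultimately show "s \<in> inverted K D (fractions K F D)" by (simp add: inverted_def)
    qed
    show "inverted K D (fractions K F D) \<subseteq> F"
    proof
      fix u assume "u \<in> inverted K D (fractions K F D)"
      then obtain a s where u: "u \<in> D - {\<zero>}" "inv u = a \<otimes> inv s" "a \<in> D" "s \<in> F"
        by (auto simp: inverted_def fractions_def)
      have s: "s \<in> D - {\<zero>}" using FD u(4) by blast
      note [simp] = inv_in_carrier[OF s] inv_in_carrier[OF u(1)] D_carrier[OF u(3)]
      have "s = s \<otimes> (u \<otimes> inv u)" using nonzero_r_inv[OF u(1)] s D_carrier by simp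
      also have "\<dots> = (a \<otimes> u) \<otimes> (s \<otimes> inv s)" unfolding u(2) using s u(1) D_carrier by (simp add: m_ac)
      also have "\<dots> = a \<otimes> u" using nonzero_r_inv[OF s] u(1) D_carrier by simp
      finally show "u \<in> F" using FD(4)[OF u(3), of u] u(1,4) by simp
    qed
  qed
qed

lemma bij_betw_inverted: "bij_betw (inverted K D) (Over_qr K D) {F. saturated K D F}"
proof (rule bij_betw_byWitness[where f' = "\<lambda>F. fractions K F D"])
  have "Over_qr K D \<subseteq> Over K D" by (auto simp: Over_qr_def)
  then show "inverted K D ` Over_qr K D \<subseteq> {F. saturated K D F}" using saturated_inverted by blast
qed (auto simp: fractions_inverted saturated_fractions)

text \<open>
  Being saturated is a conjunction of conditions that involve at most two elements of the set at a
  time, each of which is preserved by intersections.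
\<close>
lemma algebraic_family_saturated: "algebraic_family {G. saturated K D (Wo -` G)}"
proof
  fix \<G> :: "'a wo set set" assume "\<G> \<subseteq> {G. saturated K D (Wo -` G)}" "\<G> \<noteq> {}"
  then show "\<Inter>\<G> \<in> {G. saturated K D (Wo -` G)}"
    unfolding saturated_def by (simp add: subset_iff) blast
next
  fix F :: "'a wo set"
  assume fin: "\<And>B. finite B \<Longrightarrow> B \<subseteq> F \<Longrightarrow> \<exists>C\<in>{G. saturated K D (Wo -` G)}. B \<subseteq> C \<and> C \<subseteq> F"
  have "\<one> \<in> Wo -` F"
    using fin[of "{}"] by (auto simp: saturated_def)
  moreover have "s \<in> D - {\<zero>}" if "Wo s \<in> F" for s
    using fin[of "{Wo s}"] that by (auto simp: saturated_def)
  moreover have "Wo (s \<otimes> t) \<in> F \<longleftrightarrow> Wo s \<in> F \<and> Wo t \<in> F" if "s \<in> D" "t \<in> D" for s t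
  proof
    assume "Wo (s \<otimes> t) \<in> F"
    then show "Wo s \<in> F \<and> Wo t \<in> F"
      using fin[of "{Wo (s \<otimes> t)}"] that by (auto simp: saturated_def)
  next
    assume "Wo s \<in> F \<and> Wo t \<in> F"
    then show "Wo (s \<otimes> t) \<in> F"
      using fin[of "{Wo s, Wo t}"] that by (auto simp: saturated_def)
  qed
  ultimately show "F \<in> {G. saturated K D (Wo -` G)}" by (auto simp: saturated_def)
qed

text \<open>
  In a quotient ring \<open>T\<close>, finitely many elements can be written as \<open>a / s\<close> with \<open>1 / s \<in> T\<close>; any
  overring containing these \<open>1 / s\<close> contains the given elements as well.  So the sets given by
  finitely many reciprocals suffice as a basis.
\<close>
lemma openin_Over_qr:
  assumes U: "U \<subseteq> Over_qr K D"
  shows "openin (subtopology (over_topology K D) (Over_qr K D)) U \<longleftrightarrow>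
    (\<forall>T\<in>U. \<exists>B. finite B \<and> B \<subseteq> inverted K D T \<and>
      (\<forall>T'\<in>Over_qr K D. B \<subseteq> inverted K D T' \<longrightarrow> T' \<in> U))"
proof
  assume "openin (subtopology (over_topology K D) (Over_qr K D)) U"
  then obtain V where V: "openin (over_topology K D) V" "U = V \<inter> Over_qr K D"
    by (auto simp: openin_subtopology)
  show "\<forall>T\<in>U. \<exists>B. finite B \<and> B \<subseteq> inverted K D T \<and>
      (\<forall>T'\<in>Over_qr K D. B \<subseteq> inverted K D T' \<longrightarrow> T' \<in> U)"
  proof
    fix T assume T: "T \<in> U"
    then obtain E where E: "finite E" "T \<in> over_basic K D E" "over_basic K D E \<subseteq> V"
      using V unfolding openin_over_topology arbitrary_union_of_alt by blast
    have "\<exists>s. s \<in> inverted K D T \<and> (\<exists>a\<in>D. x = a \<otimes> inv s)" if "x \<in> E" for x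
    proof -
      have "x \<in> fractions K (inverted K D T) D"
        using fractions_inverted[of T] T V(2) E(2) that by (auto simp: over_basic_def)
      then show ?thesis by (auto simp: fractions_def)
    qed
    then obtain s where s: "\<And>x. x \<in> E \<Longrightarrow> s x \<in> inverted K D T \<and> (\<exists>a\<in>D. x = a \<otimes> inv (s x))" by metis
    have "T' \<in> U" if T': "T' \<in> Over_qr K D" "s ` E \<subseteq> inverted K D T'" for T'
    proof -
      have "x \<in> T'" if "x \<in> E" for x
      proof -
        obtain a where "a \<in> D" "x = a \<otimes> inv (s x)" using s[OF \<open>x \<in> E\<close>] by blast
        moreover have "s x \<in> inverted K D T'" using T'(2) \<open>x \<in> E\<close> by blast
        ultimately have "x \<in> fractions K (inverted K D T') D"
          by (auto simp: fractions_def)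
        then show ?thesis using fractions_inverted[OF T'(1)] by blast
      qed
      then have "T' \<in> over_basic K D E" using T'(1) by (auto simp: over_basic_def Over_qr_def)
      then show ?thesis using E(3) V(2) T'(1) by blast
    qed
    then show "\<exists>B. finite B \<and> B \<subseteq> inverted K D T \<and>
      (\<forall>T'\<in>Over_qr K D. B \<subseteq> inverted K D T' \<longrightarrow> T' \<in> U)"
      using E(1) s by (intro exI[of _ "s ` E"]) auto
  qed
next
  assume R: "\<forall>T\<in>U. \<exists>B. finite B \<and> B \<subseteq> inverted K D T \<and>
      (\<forall>T'\<in>Over_qr K D. B \<subseteq> inverted K D T' \<longrightarrow> T' \<in> U)"
  define V where "V = \<Union>{W. openin (over_topology K D) W \<and> W \<inter> Over_qr K D \<subseteq> U}"
  have "openin (over_topology K D) V" unfolding V_def by (rule openin_Union) blast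
  moreover have "T \<in> V" if T: "T \<in> U" for T
  proof -
    obtain B where B: "finite B" "B \<subseteq> inverted K D T"
      "\<And>T'. T' \<in> Over_qr K D \<Longrightarrow> B \<subseteq> inverted K D T' \<Longrightarrow> T' \<in> U" using R T by meson
    let ?W = "over_basic K D (m_inv K ` B)"
    have BD: "B \<subseteq> D - {\<zero>}" using B(2) by (auto simp: inverted_def)
    have "openin (over_topology K D) ?W"
      unfolding openin_over_topology
      using B(1) BD inv_in_carrier by (intro arbitrary_union_of_inc exI[of _ "m_inv K ` B"]) auto
    moreover have "?W \<inter> Over_qr K D \<subseteq> U"
      using B(3) BD by (auto simp: over_basic_def inverted_def)
    moreover have "T \<in> ?W"
      using B(2) T U by (auto simp: over_basic_def inverted_def Over_qr_def)
    ultimately show ?thesis unfolding V_def by blast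
  qed
  then have "U = V \<inter> Over_qr K D" using U unfolding V_def by blast
  ultimately show "openin (subtopology (over_topology K D) (Over_qr K D)) U"
    unfolding openin_subtopology by blast
qed

lemma spectral_space_Over_qr: "spectral_space (subtopology (over_topology K D) (Over_qr K D))"
proof (rule algebraic_family.spectral_spaceI[OF algebraic_family_saturated])
  let ?X = "subtopology (over_topology K D) (Over_qr K D)"
  have X: "topspace ?X = Over_qr K D"
    by (auto simp: topspace_over_topology Over_qr_def)
  have "bij_betw ((`) Wo) {F. saturated K D F} {G. saturated K D (Wo -` G)}"
  proof (rule bij_betw_byWitness[where f' = "(-`) Wo"])
    show "\<forall>G\<in>{G. saturated K D (Wo -` G)}. Wo ` (Wo -` G) = G"
      by (auto simp: image_iff) (metis wo.exhaust)
  qed (auto simp: inj_vimage_image_eq inj_def)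
  from bij_betw_trans[OF bij_betw_inverted this]
  show "bij_betw (\<lambda>T. Wo ` inverted K D T) (topspace ?X) {G. saturated K D (Wo -` G)}"
    unfolding X o_def .
  fix U assume "U \<subseteq> topspace ?X"
  then have U: "U \<subseteq> Over_qr K D" by (simp add: X)
  have "(\<exists>B. finite B \<and> B \<subseteq> inverted K D T \<and> (\<forall>T'\<in>Over_qr K D. B \<subseteq> inverted K D T' \<longrightarrow> T' \<in> U)) \<longleftrightarrow>
    (\<exists>B. finite B \<and> B \<subseteq> Wo ` inverted K D T \<and> (\<forall>T'\<in>Over_qr K D. B \<subseteq> Wo ` inverted K D T' \<longrightarrow> T' \<in> U))"
    (is "?L \<longleftrightarrow> ?R") for T
  proof
    assume ?L
    then obtain B where B: "finite B" "B \<subseteq> inverted K D T" "\<forall>T'\<in>Over_qr K D. B \<subseteq> inverted K D T' \<longrightarrow> T' \<in> U"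
      by blast
    have "Wo ` B \<subseteq> Wo ` A \<longleftrightarrow> B \<subseteq> A" for A by (rule inj_image_subset_iff) (simp add: inj_def)
    then show ?R using B by (intro exI[of _ "Wo ` B"]) simp
  next
    assume ?R
    then obtain B where B: "finite B" "B \<subseteq> Wo ` inverted K D T"
      "\<forall>T'\<in>Over_qr K D. B \<subseteq> Wo ` inverted K D T' \<longrightarrow> T' \<in> U" by blast
    have "B \<subseteq> Wo ` A \<longleftrightarrow> unWo ` B \<subseteq> A" for A by force
    then show ?L using B by (intro exI[of _ "unWo ` B"]) simp
  qed
  then show "openin ?X U \<longleftrightarrow> (\<forall>x\<in>U. \<exists>B. finite B \<and> B \<subseteq> Wo ` inverted K D x \<and>
      (\<forall>y\<in>topspace ?X. B \<subseteq> Wo ` inverted K D y \<longrightarrow> y \<in> U))"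
    unfolding openin_Over_qr[OF U] X by simp
next
  show "(UNIV :: 'a wo set set) \<lesssim> (UNIV :: ('a set + nat) set)"
    unfolding lepoll_def
    by (intro exI[of _ "\<lambda>G. Inl (Wo -` G)"]) (auto simp: inj_on_def vimage_def set_eq_iff, (metis wo.exhaust)+)
qed

end

theorem corollary4p3:
  fixes K :: "('a, 'm) ring_scheme" and D :: "'a set"
  assumes "quotient_field_of K D"
  shows "spectral_space (subtopology (over_topology K D) (Over_qr K D))"
proof -
  have "subdomain_of_field K D"
    using assms unfolding quotient_field_of_def subdomain_of_field_def subdomain_of_field_axioms_def by blast
  then show ?thesis by (rule subdomain_of_field.spectral_space_Over_qr)
qed

end
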